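(* Let $(\Sigma,g)$ be an $n$-dimensional submanifold of a pseudo-Riemannian manifold $(M,\eta)$, with induced (nondegenerate) metric $g$, equipped with an $(N+1)$-multilinear bracket satisfying the compatibility relation described in the context, and let $\bar R$ and $R$ be the curvature tensors of $(M,\eta)$ and $(\Sigma,g)$ respectively. Let $\mathcal{D}$, $\Pi$ and $\hat\nabla$ be defined from the bracket as in the context. Then for all $X,Y,Z,V\in T\Sigma$, $$R(X,Y,Z,V)=\Big(\bar R_{ijkl}+(\hat\nabla_k\Pi_{mi})(\hat\nabla_l{\Pi^m}_j)-(\hat\nabla_k\Pi_{mj})(\hat\nabla_l{\Pi^m}_i)\Big)X^iY^jZ^kV^l .$$
   Context: Setting. $(M,\eta)$ is a pseudo-Riemannian manifold of dimension $m$ with Levi-Civita connection $\bar\nabla$ (Christoffel symbols $\bar\Gamma^i_{jk}$) and local coordinates $x^1,\dots,x^m$; $(\Sigma,g)$ is an $n$-dimensional submanifold with induced nondegenerate metric $g$ and Levi-Civita connection $\nabla$, given locally by $x^i(u^1,\dots,u^n)$. Everything is local in these coordinates. Indices $i,j,k,\dots$ run over $1,\dots,m$ and are raised and lowered with $\eta$; $a,b,c,\dots$ run over $1,\dots,n$; repeated indices are summed. $T\Sigma$ is regarded as a subspace of $TM$ (along $\Sigma$) with basis $e_a=(\partial_a x^i)\partial_i$, and $g_{ab}=\eta(e_a,e_b)$, with inverse $g^{ab}$. Bracket. $\{\cdot,\dots,\cdot\}$ is an $(N+1)$-multilinear map $C^\infty(\Sigma)^{N+1}\to C^\infty(\Sigma)$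 satisfying the Leibniz rule in each argument (antisymmetry is not assumed). For a multi-index $I=(i_1\cdots i_N)$ write $\{f,\vec x^I\}=\{f,x^{i_1},\dots,x^{i_N}\}$, $\eta_{IJ}=\eta_{i_1j_1}\cdots\eta_{i_Nj_N}$ and $\mathcal{P}^{iI}=\frac1{\sqrt{N!}}\{x^i,\vec x^I\}$. Compatibility assumption: there are $\gamma\in C^\infty(\Sigma)$ with $\gamma>0$ and $\epsilon\in\{-1,1\}$ such that $\mathcal{P}^{iI}\mathcal{P}^{jJ}\eta_{IJ}=\epsilon\gamma^2g^{ab}(\partial_ax^i)(\partial_bx^j)$. Derived objects. $\mathcal{D}^{ij}=\frac{\epsilon}{\gamma^2}\mathcal{P}^{iI}\mathcal{P}^{jJ}\eta_{IJ}$, $\mathcal{D}(X)=\mathcal{D}^{ij}\eta_{jk}X^k\partial_i$ for $X\in TM$, and $\Pi=\mathrm{id}-\mathcal{D}$ (components ${\Pi^i}_k=\delta^i_k-{\mathcal{D}^i}_k$). $\hat\nabla_XT=\bar\nabla_{\mathcal{D}(X)}T$ for tensors $T$ of $M$ along $\Sigma$, i.e. $\hat\nabla_j={\mathcal{D}_j}^l\bar\nabla_l$ (this differentiates only in directions tangent to $\Sigma$). In bracket form, with $\mathcal{D}^i(f)=\frac{\epsilon}{\gamma^2N!}\{x^i,\vec x^I\}\{f,\vec x^J\}\eta_{IJ}$, one has $\hat\nabla_jY^i=\mathcal{D}_j(Y^i)+{\mathcal{D}_j}^l\bar\Gamma^i_{lk}Y^k$. Curvature conventions. $R(X,Y)Z=\nabla_X\nabla_YZ-\nabla_Y\nabla_XZ-\nabla_{[X,Y]}Z$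 and $R(X,Y,Z,V)=g(R(Z,V)Y,X)$ (Kobayashi–Nomizu convention); likewise $\bar R_{ijkl}=\eta(\bar R(\partial_k,\partial_l)\partial_j,\partial_i)$. *)

theory Defs
  imports "HOL-Analysis.Analysis"
begin

text \<open>
  Everything is expressed in local coordinates. The ambient manifold is an open set \<open>U\<close> of
  \<open>real^'m\<close> with metric components \<open>\<eta>\<close>; the submanifold is given by a parametrization
  \<open>x\<close> defined on an open set \<open>W\<close> of \<open>real^'n\<close>. Functions and tensor fields along the submanifold
  are functions of the parameter \<open>u \<in> W\<close>, and their values outside of \<open>W\<close> are irrelevant.
\<close>

section \<open>Smooth functions on open sets\<close>

definition pd :: "'k::finite \<Rightarrow> (real^'k \<Rightarrow> real) \<Rightarrow> real^'k \<Rightarrow> real" where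
  "pd i f p = frechet_derivative f (at p) (axis i 1)"

primrec Ck_on :: "nat \<Rightarrow> (real^'k::finite) set \<Rightarrow> (real^'k \<Rightarrow> real) \<Rightarrow> bool" where
  "Ck_on 0 S f \<longleftrightarrow> continuous_on S f"
| "Ck_on (Suc r) S f \<longleftrightarrow> f differentiable_on S \<and> (\<forall>i. Ck_on r S (pd i f))"

definition smooth_on :: "(real^'k::finite) set \<Rightarrow> (real^'k \<Rightarrow> real) \<Rightarrow> bool" where
  "smooth_on S f \<longleftrightarrow> (\<forall>r. Ck_on r S f)"

definition smooth_field_on :: "(real^'k::finite) set \<Rightarrow> (real^'k \<Rightarrow> real^'l::finite) \<Rightarrow> bool" where
  "smooth_field_on S X \<longleftrightarrow> (\<forall>i. smooth_on S (\<lambda>p. X p $ i))"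


section \<open>Pseudo-Riemannian metrics, Levi-Civita connection, curvature\<close>

definition pseudo_metric_on ::
    "(real^'k::finite) set \<Rightarrow> (real^'k \<Rightarrow> real^'k^'k) \<Rightarrow> bool" where
  "pseudo_metric_on S h \<longleftrightarrow>
     (\<forall>i j. smooth_on S (\<lambda>p. h p $ i $ j)) \<and>
     (\<forall>p\<in>S. transpose (h p) = h p \<and> invertible (h p))"

definition form :: "real^'k^'k \<Rightarrow> real^'k \<Rightarrow> real^'k \<Rightarrow> real" where
  "form A v w = v \<bullet> (A *v w)"

text \<open>\<open>christoffel h i j k p\<close> is the Christoffel symbol with upper index \<open>i\<close> and lower indices
  \<open>j\<close>, \<open>k\<close>. The two lemmas below show that it is the torsion-free metric connection.\<close>

definition christoffel ::
    "(real^'k::finite \<Rightarrow> real^'k^'k) \<Rightarrow> 'k \<Rightarrow> 'k \<Rightarrow> 'k \<Rightarrow> real^'k \<Rightarrow> real" where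
  "christoffel h i j k p =
     (1/2) * (\<Sum>l\<in>UNIV. matrix_inv (h p) $ i $ l *
        (pd j (\<lambda>q. h q $ l $ k) p + pd k (\<lambda>q. h q $ l $ j) p - pd l (\<lambda>q. h q $ j $ k) p))"

definition covderiv ::
    "(real^'k::finite \<Rightarrow> real^'k^'k) \<Rightarrow> (real^'k \<Rightarrow> real^'k) \<Rightarrow> (real^'k \<Rightarrow> real^'k) \<Rightarrow> real^'k \<Rightarrow> real^'k"
  where
  "covderiv h X Y p = (\<chi> i. (\<Sum>j\<in>UNIV. X p $ j * pd j (\<lambda>q. Y q $ i) p)
     + (\<Sum>j\<in>UNIV. \<Sum>k\<in>UNIV. christoffel h i j k p * X p $ j * Y p $ k))"

definition lie_bracket ::
    "(real^'k::finite \<Rightarrow> real^'k) \<Rightarrow> (real^'k \<Rightarrow> real^'k) \<Rightarrow> real^'k \<Rightarrow> real^'k" where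
  "lie_bracket X Y p = (\<chi> i. \<Sum>j\<in>UNIV.
     X p $ j * pd j (\<lambda>q. Y q $ i) p - Y p $ j * pd j (\<lambda>q. X q $ i) p)"

definition curvature ::
    "(real^'k::finite \<Rightarrow> real^'k^'k) \<Rightarrow> (real^'k \<Rightarrow> real^'k) \<Rightarrow> (real^'k \<Rightarrow> real^'k) \<Rightarrow>
     (real^'k \<Rightarrow> real^'k) \<Rightarrow> real^'k \<Rightarrow> real^'k" where
  "curvature h X Y Z p =
     covderiv h X (covderiv h Y Z) p - covderiv h Y (covderiv h X Z) p
     - covderiv h (lie_bracket X Y) Z p"

text \<open>Kobayashi--Nomizu convention: \<open>R(X,Y,Z,V) = h(R(Z,V)Y, X)\<close>.\<close>

definition curvature4 ::
    "(real^'k::finite \<Rightarrow> real^'k^'k) \<Rightarrow> (real^'k \<Rightarrow> real^'k) \<Rightarrow> (real^'k \<Rightarrow> real^'k) \<Rightarrow>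
     (real^'k \<Rightarrow> real^'k) \<Rightarrow> (real^'k \<Rightarrow> real^'k) \<Rightarrow> real^'k \<Rightarrow> real" where
  "curvature4 h X Y Z V p = form (h p) (curvature h Z V Y p) (X p)"

definition coord_field :: "'k \<Rightarrow> real^'k::finite \<Rightarrow> real^'k" where
  "coord_field i = (\<lambda>p. axis i 1)"

definition curvature_comp ::
    "(real^'k::finite \<Rightarrow> real^'k^'k) \<Rightarrow> 'k \<Rightarrow> 'k \<Rightarrow> 'k \<Rightarrow> 'k \<Rightarrow> real^'k \<Rightarrow> real" where
  "curvature_comp h i j k l =
     curvature4 h (coord_field i) (coord_field j) (coord_field k) (coord_field l)"

lemma pseudo_metric_on_sym:
  assumes "pseudo_metric_on S h" "p \<in> S"
  shows "h p $ i $ j = h p $ j $ i"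
proof -
  have "transpose (h p) $ i $ j = h p $ i $ j"
    using assms by (simp add: pseudo_metric_on_def)
  then show ?thesis
    by (simp add: transpose_def)
qed

lemma pseudo_metric_on_pd_sym:
  assumes "open S" "pseudo_metric_on S h" "p \<in> S"
  shows "pd k (\<lambda>q. h q $ i $ j) p = pd k (\<lambda>q. h q $ j $ i) p"
proof -
  have "Ck_on (Suc 0) S (\<lambda>q. h q $ i $ j)"
    using assms(2) unfolding pseudo_metric_on_def smooth_on_def by blast
  then have "(\<lambda>q. h q $ i $ j) differentiable at p"
    using assms(1,3) by (auto simp: differentiable_on_eq_differentiable_at)
  then have "frechet_derivative (\<lambda>q. h q $ i $ j) (at p) = frechet_derivative (\<lambda>q. h q $ j $ i) (at p)"
    using assms(1,3) pseudo_metric_on_sym[OF assms(2)]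
    by (intro frechet_derivative_transform_within_open[where X = S])
  then show ?thesis
    by (simp add: pd_def)
qed

lemma christoffel_torsion_free:
  assumes "open S" "pseudo_metric_on S h" "p \<in> S"
  shows "christoffel h i j k p = christoffel h i k j p"
  unfolding christoffel_def
  by (intro arg_cong2[where f = "(*)"] sum.cong refl)
     (simp only: pseudo_metric_on_pd_sym[OF assms, of _ j k] add.commute)

lemma christoffel_metric:
  assumes "open S" "pseudo_metric_on S h" "p \<in> S"
  shows "pd k (\<lambda>q. h q $ i $ j) p =
    (\<Sum>l\<in>UNIV. christoffel h l k i p * h p $ l $ j) + (\<Sum>l\<in>UNIV. christoffel h l k j p * h p $ i $ l)"
proof -
  note pds = pseudo_metric_on_pd_sym[OF assms]
  note sym = pseudo_metric_on_sym[OF assms(2,3)]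
  have "invertible (h p)"
    using assms(2,3) by (simp add: pseudo_metric_on_def)
  then have "h p ** matrix_inv (h p) = mat 1"
    unfolding invertible_def matrix_inv_def by (rule someI2_ex) simp
  then have inv: "(\<Sum>l\<in>UNIV. h p $ a $ l * matrix_inv (h p) $ l $ b) = (if a = b then 1 else 0)"
    for a b
  proof -
    have "(h p ** matrix_inv (h p)) $ a $ b = (mat 1 :: real^'a^'a) $ a $ b"
      using \<open>h p ** matrix_inv (h p) = mat 1\<close> by simp
    then show ?thesis
      by (simp add: matrix_matrix_mult_def mat_def)
  qed
  have low: "(\<Sum>l\<in>UNIV. christoffel h l b c p * h p $ a $ l) =
      (pd b (\<lambda>q. h q $ a $ c) p + pd c (\<lambda>q. h q $ a $ b) p - pd a (\<lambda>q. h q $ b $ c) p) / 2"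
    for a b c
  proof -
    define F where "F e = pd b (\<lambda>q. h q $ e $ c) p + pd c (\<lambda>q. h q $ e $ b) p
      - pd e (\<lambda>q. h q $ b $ c) p" for e
    have "(\<Sum>l\<in>UNIV. christoffel h l b c p * h p $ a $ l) =
        (\<Sum>l\<in>UNIV. \<Sum>e\<in>UNIV. (h p $ a $ l * matrix_inv (h p) $ l $ e) * F e / 2)"
      by (simp add: christoffel_def F_def[symmetric] sum_distrib_left sum_distrib_right
          sum_divide_distrib mult_ac)
    also have "\<dots> = (\<Sum>e\<in>UNIV. \<Sum>l\<in>UNIV. (h p $ a $ l * matrix_inv (h p) $ l $ e) * F e / 2)"
      by (rule sum.swap)
    also have "\<dots> = (\<Sum>e\<in>UNIV. (if a = e then 1 else 0) * F e / 2)"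
      unfolding sum_divide_distrib[symmetric] sum_distrib_right[symmetric] inv ..
    also have "\<dots> = F a / 2"
      by (simp add: if_distrib[of "\<lambda>t. t * _"] sum_divide_distrib[symmetric] cong: if_cong)
    finally show ?thesis
      by (simp add: F_def)
  qed
  have "(\<Sum>l\<in>UNIV. christoffel h l k i p * h p $ l $ j) =
        (\<Sum>l\<in>UNIV. christoffel h l k i p * h p $ j $ l)"
    by (simp only: sym[of _ j])
  then show ?thesis
    unfolding low pds[of k j i] pds[of i j k] pds[of j k i] by (simp add: field_simps)
qed


section \<open>Submanifolds\<close>

text \<open>The basis \<open>e\<^sub>a = (\<partial>\<^sub>a x\<^sup>i) \<partial>\<^sub>i\<close> of the tangent space.\<close>

definition tangent_basis ::
    "(real^'n::finite \<Rightarrow> real^'m::finite) \<Rightarrow> 'n \<Rightarrow> real^'n \<Rightarrow> real^'m" where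
  "tangent_basis x a u = (\<chi> i. pd a (\<lambda>v. x v $ i) u)"

definition push ::
    "(real^'n::finite \<Rightarrow> real^'m::finite) \<Rightarrow> real^'n \<Rightarrow> real^'n \<Rightarrow> real^'m" where
  "push x u \<xi> = (\<Sum>a\<in>UNIV. \<xi> $ a *\<^sub>R tangent_basis x a u)"

definition immersion_on :: "(real^'n::finite) set \<Rightarrow> (real^'n \<Rightarrow> real^'m::finite) \<Rightarrow> bool" where
  "immersion_on W x \<longleftrightarrow> smooth_field_on W x \<and> (\<forall>u\<in>W. inj (push x u))"

definition induced_metric ::
    "(real^'m::finite \<Rightarrow> real^'m^'m) \<Rightarrow> (real^'n::finite \<Rightarrow> real^'m) \<Rightarrow> real^'n \<Rightarrow> real^'n^'n" where
  "induced_metric \<eta> x u = (\<chi> a b. form (\<eta> (x u)) (tangent_basis x a u) (tangent_basis x b u))"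

text \<open>Derivative of a function along the submanifold in the direction of a vector \<open>w\<close> of the ambient
  space that is tangent to the submanifold: \<open>w(f) = \<xi>\<^sup>a \<partial>\<^sub>a f\<close> where \<open>w = \<xi>\<^sup>a e\<^sub>a\<close>. This and the
  covariant derivatives below are meaningful for tangent \<open>w\<close> only.\<close>

definition tangent_deriv ::
    "(real^'n::finite \<Rightarrow> real^'m::finite) \<Rightarrow> real^'n \<Rightarrow> real^'m \<Rightarrow> (real^'n \<Rightarrow> real) \<Rightarrow> real" where
  "tangent_deriv x u w f = (\<Sum>a\<in>UNIV. (THE \<xi>. push x u \<xi> = w) $ a * pd a f u)"

text \<open>Ambient covariant derivative at \<open>x u\<close>, in a tangent direction \<open>w\<close>, of a tensor field along the
  submanifold with two lower indices, and of one with components \<open>T u $ i $ j\<close> where \<open>i\<close> is an upper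
  and \<open>j\<close> a lower index.\<close>

definition covderiv_low_low ::
    "(real^'m::finite \<Rightarrow> real^'m^'m) \<Rightarrow> (real^'n::finite \<Rightarrow> real^'m) \<Rightarrow> real^'n \<Rightarrow> real^'m \<Rightarrow>
     (real^'n \<Rightarrow> real^'m^'m) \<Rightarrow> 'm \<Rightarrow> 'm \<Rightarrow> real" where
  "covderiv_low_low \<eta> x u w T i j = tangent_deriv x u w (\<lambda>v. T v $ i $ j)
     - (\<Sum>l\<in>UNIV. \<Sum>k\<in>UNIV. w $ l * christoffel \<eta> k l i (x u) * T u $ k $ j)
     - (\<Sum>l\<in>UNIV. \<Sum>k\<in>UNIV. w $ l * christoffel \<eta> k l j (x u) * T u $ i $ k)"

definition covderiv_up_low ::
    "(real^'m::finite \<Rightarrow> real^'m^'m) \<Rightarrow> (real^'n::finite \<Rightarrow> real^'m) \<Rightarrow> real^'n \<Rightarrow> real^'m \<Rightarrow>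
     (real^'n \<Rightarrow> real^'m^'m) \<Rightarrow> 'm \<Rightarrow> 'm \<Rightarrow> real" where
  "covderiv_up_low \<eta> x u w T i j = tangent_deriv x u w (\<lambda>v. T v $ i $ j)
     + (\<Sum>l\<in>UNIV. \<Sum>k\<in>UNIV. w $ l * christoffel \<eta> i l k (x u) * T u $ k $ j)
     - (\<Sum>l\<in>UNIV. \<Sum>k\<in>UNIV. w $ l * christoffel \<eta> k l j (x u) * T u $ i $ k)"


section \<open>Multilinear brackets\<close>

text \<open>An \<open>(N+1)\<close>-ary bracket takes the list of its \<open>N+1\<close> arguments. The second clause says that
  it is a map on smooth functions on \<open>W\<close>, i.e. that it ignores their values outside of \<open>W\<close>.\<close>

definition leibniz_bracket_on ::
    "(real^'n::finite) set \<Rightarrow> nat \<Rightarrow> ((real^'n \<Rightarrow> real) list \<Rightarrow> real^'n \<Rightarrow> real) \<Rightarrow> bool" where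
  "leibniz_bracket_on W N br \<longleftrightarrow>
     (\<forall>fs. length fs = Suc N \<and> (\<forall>f\<in>set fs. smooth_on W f) \<longrightarrow>
        smooth_on W (br fs) \<and>
        (\<forall>gs. list_all2 (\<lambda>f g. \<forall>u\<in>W. f u = g u) fs gs \<and> (\<forall>g\<in>set gs. smooth_on W g) \<longrightarrow>
           (\<forall>u\<in>W. br fs u = br gs u)) \<and>
        (\<forall>r<Suc N. \<forall>f g. smooth_on W f \<and> smooth_on W g \<longrightarrow>
           (\<forall>a b. \<forall>u\<in>W. br (fs[r := (\<lambda>v. a * f v + b * g v)]) u
                = a * br (fs[r := f]) u + b * br (fs[r := g]) u) \<and>
           (\<forall>u\<in>W. br (fs[r := (\<lambda>v. f v * g v)]) u
                = f u * br (fs[r := g]) u + g u * br (fs[r := f]) u)))"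

definition multi_indices :: "nat \<Rightarrow> 'm list set" where
  "multi_indices N = {I. length I = N}"

definition multi_metric :: "real^'m^'m \<Rightarrow> 'm list \<Rightarrow> 'm list \<Rightarrow> real" where
  "multi_metric A I J = (\<Prod>r<length I. A $ (I ! r) $ (J ! r))"

definition bracket_P ::
    "((real^'n::finite \<Rightarrow> real) list \<Rightarrow> real^'n \<Rightarrow> real) \<Rightarrow> nat \<Rightarrow> (real^'n \<Rightarrow> real^'m::finite) \<Rightarrow>
     'm \<Rightarrow> 'm list \<Rightarrow> real^'n \<Rightarrow> real" where
  "bracket_P br N x i I u =
     1 / sqrt (fact N) * br ((\<lambda>v. x v $ i) # map (\<lambda>k v. x v $ k) I) u"

text \<open>The components \<open>P\<^sup>i\<^sup>I P\<^sup>j\<^sup>J \<eta>\<^sub>I\<^sub>J\<close>.\<close>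

definition bracket_PP ::
    "((real^'n::finite \<Rightarrow> real) list \<Rightarrow> real^'n \<Rightarrow> real) \<Rightarrow> nat \<Rightarrow> (real^'m::finite \<Rightarrow> real^'m^'m) \<Rightarrow>
     (real^'n \<Rightarrow> real^'m) \<Rightarrow> real^'n \<Rightarrow> real^'m^'m" where
  "bracket_PP br N \<eta> x u = (\<chi> i j. \<Sum>I\<in>multi_indices N. \<Sum>J\<in>multi_indices N.
     bracket_P br N x i I u * bracket_P br N x j J u * multi_metric (\<eta> (x u)) I J)"

definition bracket_compatible_on ::
    "(real^'n::finite) set \<Rightarrow> ((real^'n \<Rightarrow> real) list \<Rightarrow> real^'n \<Rightarrow> real) \<Rightarrow> nat \<Rightarrow>
     (real^'m::finite \<Rightarrow> real^'m^'m) \<Rightarrow> (real^'n \<Rightarrow> real^'m) \<Rightarrow> real \<Rightarrow> (real^'n \<Rightarrow> real) \<Rightarrow> bool" where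
  "bracket_compatible_on W br N \<eta> x \<epsilon> \<gamma> \<longleftrightarrow> (\<forall>u\<in>W. \<forall>i j.
     bracket_PP br N \<eta> x u $ i $ j = \<epsilon> * (\<gamma> u)\<^sup>2 *
       (\<Sum>a\<in>UNIV. \<Sum>b\<in>UNIV. matrix_inv (induced_metric \<eta> x u) $ a $ b *
          pd a (\<lambda>v. x v $ i) u * pd b (\<lambda>v. x v $ j) u))"

text \<open>The derived objects. \<open>bracket_D\<close> has components \<open>D\<^sup>i\<^sup>j\<close>; \<open>bracket_D_mixed\<close> is the matrix,
  with components \<open>D\<^sup>i\<^sub>k = D\<^sup>i\<^sup>j \<eta>\<^sub>j\<^sub>k\<close>, of the endomorphism \<open>D(X) = D\<^sup>i\<^sup>j \<eta>\<^sub>j\<^sub>k X\<^sup>k \<partial>\<^sub>i\<close>.\<close>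

definition bracket_D ::
    "((real^'n::finite \<Rightarrow> real) list \<Rightarrow> real^'n \<Rightarrow> real) \<Rightarrow> nat \<Rightarrow> (real^'m::finite \<Rightarrow> real^'m^'m) \<Rightarrow>
     (real^'n \<Rightarrow> real^'m) \<Rightarrow> real \<Rightarrow> (real^'n \<Rightarrow> real) \<Rightarrow> real^'n \<Rightarrow> real^'m^'m" where
  "bracket_D br N \<eta> x \<epsilon> \<gamma> u = (\<epsilon> / (\<gamma> u)\<^sup>2) *\<^sub>R bracket_PP br N \<eta> x u"

definition bracket_D_mixed ::
    "((real^'n::finite \<Rightarrow> real) list \<Rightarrow> real^'n \<Rightarrow> real) \<Rightarrow> nat \<Rightarrow> (real^'m::finite \<Rightarrow> real^'m^'m) \<Rightarrow>
     (real^'n \<Rightarrow> real^'m) \<Rightarrow> real \<Rightarrow> (real^'n \<Rightarrow> real) \<Rightarrow> real^'n \<Rightarrow> real^'m^'m" where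
  "bracket_D_mixed br N \<eta> x \<epsilon> \<gamma> u = bracket_D br N \<eta> x \<epsilon> \<gamma> u ** \<eta> (x u)"

definition bracket_Pi ::
    "((real^'n::finite \<Rightarrow> real) list \<Rightarrow> real^'n \<Rightarrow> real) \<Rightarrow> nat \<Rightarrow> (real^'m::finite \<Rightarrow> real^'m^'m) \<Rightarrow>
     (real^'n \<Rightarrow> real^'m) \<Rightarrow> real \<Rightarrow> (real^'n \<Rightarrow> real) \<Rightarrow> real^'n \<Rightarrow> real^'m^'m" where
  "bracket_Pi br N \<eta> x \<epsilon> \<gamma> u = mat 1 - bracket_D_mixed br N \<eta> x \<epsilon> \<gamma> u"

definition bracket_Pi_low ::
    "((real^'n::finite \<Rightarrow> real) list \<Rightarrow> real^'n \<Rightarrow> real) \<Rightarrow> nat \<Rightarrow> (real^'m::finite \<Rightarrow> real^'m^'m) \<Rightarrow>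
     (real^'n \<Rightarrow> real^'m) \<Rightarrow> real \<Rightarrow> (real^'n \<Rightarrow> real) \<Rightarrow> real^'n \<Rightarrow> real^'m^'m" where
  "bracket_Pi_low br N \<eta> x \<epsilon> \<gamma> u = \<eta> (x u) ** bracket_Pi br N \<eta> x \<epsilon> \<gamma> u"

text \<open>\<open>hat_nabla_Pi_low \<dots> k m i\<close> and \<open>hat_nabla_Pi \<dots> k m i\<close> are the derivatives, in the direction of
  \<open>D(\<partial>\<^sub>k)\<close>, of \<open>\<Pi>\<^sub>m\<^sub>i\<close> and \<open>\<Pi>\<^sup>m\<^sub>i\<close>.\<close>

definition hat_nabla_Pi_low ::
    "((real^'n::finite \<Rightarrow> real) list \<Rightarrow> real^'n \<Rightarrow> real) \<Rightarrow> nat \<Rightarrow> (real^'m::finite \<Rightarrow> real^'m^'m) \<Rightarrow>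
     (real^'n \<Rightarrow> real^'m) \<Rightarrow> real \<Rightarrow> (real^'n \<Rightarrow> real) \<Rightarrow> real^'n \<Rightarrow> 'm \<Rightarrow> 'm \<Rightarrow> 'm \<Rightarrow> real" where
  "hat_nabla_Pi_low br N \<eta> x \<epsilon> \<gamma> u k m i =
     covderiv_low_low \<eta> x u (bracket_D_mixed br N \<eta> x \<epsilon> \<gamma> u *v axis k 1)
       (bracket_Pi_low br N \<eta> x \<epsilon> \<gamma>) m i"

definition hat_nabla_Pi ::
    "((real^'n::finite \<Rightarrow> real) list \<Rightarrow> real^'n \<Rightarrow> real) \<Rightarrow> nat \<Rightarrow> (real^'m::finite \<Rightarrow> real^'m^'m) \<Rightarrow>
     (real^'n \<Rightarrow> real^'m) \<Rightarrow> real \<Rightarrow> (real^'n \<Rightarrow> real) \<Rightarrow> real^'n \<Rightarrow> 'm \<Rightarrow> 'm \<Rightarrow> 'm \<Rightarrow> real" where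
  "hat_nabla_Pi br N \<eta> x \<epsilon> \<gamma> u k m i =
     covderiv_up_low \<eta> x u (bracket_D_mixed br N \<eta> x \<epsilon> \<gamma> u *v axis k 1)
       (bracket_Pi br N \<eta> x \<epsilon> \<gamma>) m i"

end

theory Submission
  imports Defs
begin

text \<open>
  Let \<open>E\<close> be the matrix with columns \<open>e\<^sub>a\<close>, \<open>A\<^sub>a\<close> the ambient connection pulled back along \<open>x\<close> and
  \<open>N\<^sub>a = \<partial>\<^sub>a E + A\<^sub>a E\<close>. With \<open>L = g\<^sup>-\<^sup>1 E\<^sup>T \<eta>\<close>, a left inverse of \<open>E\<close>, the compatibility relation says
  \<open>D = E L\<close>, so \<open>\<Pi> = 1 - E L\<close> is the orthogonal projection along \<open>T\<Sigma>\<close> and the connection matrices of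
  \<open>g\<close> are \<open>L N\<^sub>a\<close>. Differentiating \<open>g (L N\<^sub>b) = E\<^sup>T \<eta> N\<^sub>b\<close> and antisymmetrizing gives the Gauss equation,
  where the extrinsic terms are \<open>N\<^sub>a\<^sup>T \<eta> \<Pi> N\<^sub>b - N\<^sub>b\<^sup>T \<eta> \<Pi> N\<^sub>a\<close>. Differentiating \<open>\<Pi> E = 0\<close> gives
  \<open>(\<nabla>\<^sub>a \<Pi>) E = - \<Pi> N\<^sub>a\<close>, which turns these terms into products of derivatives of \<open>\<Pi>\<close>.
\<close>

section \<open>Partial derivatives\<close>

text \<open>Extends \<open>pd\<close> to values in any normed space, so that matrix-valued functions
  can be differentiated as a whole instead of entry by entry.\<close>

definition pdv :: "'k::finite \<Rightarrow> (real^'k \<Rightarrow> 'b::real_normed_vector) \<Rightarrow> real^'k \<Rightarrow> 'b" where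
  "pdv a f p = frechet_derivative f (at p) (axis a 1)"

lemma pd_eq_pdv: "pd a f = pdv a f"
  by (rule ext) (simp add: pd_def pdv_def)

lemma pdv_has_derivative:
  assumes "(f has_derivative f') (at p)"
  shows "pdv a f p = f' (axis a 1)"
  using frechet_derivative_at[OF assms] by (simp add: pdv_def)

lemma frechet_derivative_expansion:
  fixes f :: "real^'k \<Rightarrow> 'b::real_normed_vector"
  assumes "f differentiable at p"
  shows "frechet_derivative f (at p) w = (\<Sum>k\<in>UNIV. w $ k *\<^sub>R pdv k f p)"
proof -
  have lin: "linear (frechet_derivative f (at p))"
    by (rule linear_frechet_derivative[OF assms])
  have "w = (\<Sum>k\<in>UNIV. w $ k *\<^sub>R axis k 1)"
    by (simp add: vec_eq_iff axis_def if_distrib[of "\<lambda>t. _ * t"] cong: if_cong)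
  then show ?thesis
    using linear_sum[OF lin, of "\<lambda>k. w $ k *\<^sub>R axis k 1" UNIV] linear_cmul[OF lin]
    by (metis (no_types, lifting) pdv_def sum.cong)
qed

lemma differentiable_bounded_linear:
  assumes "bounded_linear g" "f differentiable at p"
  shows "(\<lambda>q. g (f q)) differentiable at p"
  using bounded_linear.has_derivative[OF assms(1)] assms(2) unfolding differentiable_def by blast

lemma pdv_bounded_linear:
  assumes "bounded_linear g" "f differentiable at p"
  shows "pdv a (\<lambda>q. g (f q)) p = g (pdv a f p)"
  using pdv_has_derivative[OF bounded_linear.has_derivative[OF assms(1)
        frechet_derivative_works[THEN iffD1, OF assms(2)]]]
  by (simp add: pdv_def)

lemma differentiable_bounded_bilinear:
  assumes "bounded_bilinear B" "f differentiable at p" "g differentiable at p"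
  shows "(\<lambda>q. B (f q) (g q)) differentiable at p"
  using bounded_bilinear.FDERIV[OF assms(1)] assms(2,3) unfolding differentiable_def by blast

lemma pdv_bounded_bilinear:
  assumes "bounded_bilinear B" "f differentiable at p" "g differentiable at p"
  shows "pdv a (\<lambda>q. B (f q) (g q)) p = B (f p) (pdv a g p) + B (pdv a f p) (g p)"
  using pdv_has_derivative[OF bounded_bilinear.FDERIV[OF assms(1)
        frechet_derivative_works[THEN iffD1, OF assms(2)]
        frechet_derivative_works[THEN iffD1, OF assms(3)]]]
  by (simp add: pdv_def)

lemma pdv_add:
  assumes "f differentiable at p" "g differentiable at p"
  shows "pdv a (\<lambda>q. f q + g q) p = pdv a f p + pdv a g p"
  using pdv_has_derivative[OF has_derivative_add[OF
        frechet_derivative_works[THEN iffD1, OF assms(1)]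
        frechet_derivative_works[THEN iffD1, OF assms(2)]]]
  by (simp add: pdv_def)

lemma pdv_sum:
  assumes "\<And>i. i \<in> I \<Longrightarrow> f i differentiable at p"
  shows "pdv a (\<lambda>q. \<Sum>i\<in>I. f i q) p = (\<Sum>i\<in>I. pdv a (f i) p)"
  using pdv_has_derivative[OF has_derivative_sum[OF
        frechet_derivative_works[THEN iffD1, OF assms]], of I "\<lambda>i. i" a]
  by (simp add: pdv_def)

lemma pdv_const [simp]: "pdv a (\<lambda>q. c) p = 0"
  by (simp add: pdv_def)

text \<open>Most identities below hold only on the open sets where the geometry is given; openness
  is what allows them to be differentiated.\<close>

lemma pdv_cong:
  assumes "open S" "p \<in> S" "\<And>q. q \<in> S \<Longrightarrow> f q = g q" "f differentiable at p"
  shows "pdv a f p = pdv a g p"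
  unfolding pdv_def
  using frechet_derivative_transform_within_open[OF assms(4,1,2)] assms(3) by simp

lemma differentiable_cong:
  fixes f g :: "'a::real_normed_vector \<Rightarrow> 'b::real_normed_vector"
  assumes "open S" "p \<in> S" "\<And>q. q \<in> S \<Longrightarrow> f q = g q" "f differentiable at p"
  shows "g differentiable at p"
  using assms(4) has_derivative_transform_within_open[OF _ assms(1,2)] assms(3)
  unfolding differentiable_def by blast

lemma pdv_chain:
  fixes f :: "real^'m::finite \<Rightarrow> 'b::real_normed_vector" and x :: "real^'n::finite \<Rightarrow> real^'m"
  assumes "f differentiable at (x p)" "x differentiable at p"
  shows "pdv a (\<lambda>q. f (x q)) p = (\<Sum>k\<in>UNIV. pdv a x p $ k *\<^sub>R pdv k f (x p))"
proof -
  have "pdv a (\<lambda>q. f (x q)) p = frechet_derivative f (at (x p)) (pdv a x p)"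
    using pdv_has_derivative[OF has_derivative_compose[OF
          frechet_derivative_works[THEN iffD1, OF assms(2)]
          frechet_derivative_works[THEN iffD1, OF assms(1)]]]
    by (simp add: pdv_def)
  then show ?thesis
    by (simp add: frechet_derivative_expansion[OF assms(1)])
qed

text \<open>A vector is the sum of its components placed on the axes. Since \<open>'b\<close> may
  itself be a vector type, applying this twice reduces a matrix to its entries.\<close>

lemma differentiable_vec:
  fixes f :: "'a::real_normed_vector \<Rightarrow> 'b::euclidean_space^'m::finite"
  assumes "\<And>i. (\<lambda>q. f q $ i) differentiable at p"
  shows "f differentiable at p"
proof -
  have "linear (axis i :: 'b \<Rightarrow> 'b^'m)" for i
    by (rule linearI) (simp_all add: vec_eq_iff axis_def)
  then have "bounded_linear (axis i :: 'b \<Rightarrow> 'b^'m)" for i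
    by (simp add: linear_conv_bounded_linear)
  then have "(\<lambda>q. axis i (f q $ i)) differentiable at p" for i
    using assms by (rule differentiable_bounded_linear)
  then have "(\<lambda>q. \<Sum>i\<in>UNIV. axis i (f q $ i)) differentiable at p"
    by (intro differentiable_sum) auto
  moreover have "(\<lambda>q. \<Sum>i\<in>UNIV. axis i (f q $ i)) = f"
    by (rule ext) (simp add: vec_eq_iff axis_def if_distrib cong: if_cong)
  ultimately show ?thesis
    by simp
qed

lemma differentiable_vec_nth:
  "f differentiable at p \<Longrightarrow> (\<lambda>q. f q $ i) differentiable at p"
  by (rule differentiable_bounded_linear[OF bounded_linear_vec_nth])

lemma pdv_vec_nth:
  assumes "f differentiable at p"
  shows "pdv a (\<lambda>q. f q $ i) p = pdv a f p $ i"
  by (rule pdv_bounded_linear[OF bounded_linear_vec_nth assms])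

section \<open>Smooth functions and the symmetry of second partial derivatives\<close>

lemma smooth_on_differentiable:
  assumes "open S" "smooth_on S f" "p \<in> S"
  shows "f differentiable at p"
proof -
  have "Ck_on (Suc 0) S f"
    using assms(2) unfolding smooth_on_def by blast
  then show ?thesis
    using assms(1,3) by (auto simp: differentiable_on_eq_differentiable_at)
qed

lemma smooth_on_pd: "smooth_on S f \<Longrightarrow> smooth_on S (pd i f)"
  unfolding smooth_on_def by (metis Ck_on.simps(2))

text \<open>The mean value theorem is applied twice: along \<open>A\<close> to the increment of
  \<open>f\<close> in direction \<open>B\<close>, then along \<open>B\<close> to
  \<open>pd a f\<close>. Two moves of length at most \<open>h\<close> stay in the ball of radius
  \<open>2 * h\<close>.\<close>

lemma second_difference_mean_value:
  fixes f :: "real^'k::finite \<Rightarrow> real" and a b :: 'k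
  assumes S: "open S" and f: "smooth_on S f" and h: "0 < h" and sub: "cball p (2 * h) \<subseteq> S"
  defines "A \<equiv> axis a (1::real)" and "B \<equiv> axis b (1::real)"
  obtains q where "q \<in> cball p (2 * h)"
    "f (p + h *\<^sub>R A + h *\<^sub>R B) - f (p + h *\<^sub>R A) - f (p + h *\<^sub>R B) + f p
      = h * h * pd b (pd a f) q"
proof -
  \<comment> \<open>Restriction to a coordinate line, the form in which the one-dimensional mean
    value theorem applies.\<close>
  have ray: "((\<lambda>s. g (q + s *\<^sub>R axis c 1)) has_real_derivative pd c g (q + s *\<^sub>R axis c 1)) (at s)"
    if "smooth_on S g" "q + s *\<^sub>R axis c 1 \<in> S" for g :: "real^'k \<Rightarrow> real" and q s c
  proof -
    let ?D = "frechet_derivative g (at (q + s *\<^sub>R axis c 1))"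
    have d: "g differentiable at (q + s *\<^sub>R axis c 1)"
      using smooth_on_differentiable[OF S that] .
    have "((\<lambda>s. q + s *\<^sub>R axis c 1) has_derivative (\<lambda>t. t *\<^sub>R axis c 1)) (at s)"
      by (auto intro!: derivative_eq_intros)
    from has_derivative_compose[OF this frechet_derivative_works[THEN iffD1, OF d]]
    show ?thesis
      unfolding has_field_derivative_def pd_def
      by (rule has_derivative_eq_rhs)
        (simp add: fun_eq_iff linear_cmul[OF linear_frechet_derivative[OF d]])
  qed
  have near: "p + s *\<^sub>R A + t *\<^sub>R B \<in> cball p (2 * h)" if "0 \<le> s" "s \<le> h" "0 \<le> t" "t \<le> h" for s t
  proof -
    have "norm (s *\<^sub>R A + t *\<^sub>R B) \<le> norm (s *\<^sub>R A) + norm (t *\<^sub>R B)"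
      by (rule norm_triangle_ineq)
    also have "\<dots> \<le> 2 * h"
      using that by (simp add: A_def B_def)
    finally show ?thesis
      by (simp add: dist_norm norm_minus_commute algebra_simps)
  qed
  have near': "p + t *\<^sub>R B + s *\<^sub>R A \<in> S" "p + s *\<^sub>R A + t *\<^sub>R B \<in> S" "p + s *\<^sub>R A \<in> S"
    if "0 \<le> s" "s \<le> h" "0 \<le> t" "t \<le> h" for s t
    using near[OF that] near[of s 0] that sub by (auto simp: add_ac)
  define \<phi> where "\<phi> s = f (p + h *\<^sub>R B + s *\<^sub>R A) - f (p + s *\<^sub>R A)" for s
  define \<phi>' where "\<phi>' s = pd a f (p + h *\<^sub>R B + s *\<^sub>R A) - pd a f (p + s *\<^sub>R A)" for s
  have "DERIV \<phi> s :> \<phi>' s" if "0 \<le> s" "s \<le> h" for s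
    unfolding \<phi>_def \<phi>'_def
    by (intro DERIV_diff ray[OF f, where c = a, folded A_def] near') (use that h in auto)
  from MVT2[OF h this] obtain s where s: "0 < s" "s < h" "\<phi> h - \<phi> 0 = h * \<phi>' s"
    by auto
  have "DERIV (\<lambda>t. pd a f (p + s *\<^sub>R A + t *\<^sub>R B)) t :> pd b (pd a f) (p + s *\<^sub>R A + t *\<^sub>R B)"
    if "0 \<le> t" "t \<le> h" for t
    by (intro ray[OF smooth_on_pd[OF f], where c = b, folded B_def] near') (use that s in auto)
  from MVT2[OF h this] obtain t where t: "0 < t" "t < h"
    "pd a f (p + s *\<^sub>R A + h *\<^sub>R B) - pd a f (p + s *\<^sub>R A)
      = h * pd b (pd a f) (p + s *\<^sub>R A + t *\<^sub>R B)"
    by auto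
  have "\<phi> h - \<phi> 0 = h * h * pd b (pd a f) (p + s *\<^sub>R A + t *\<^sub>R B)"
    using s(3) t(3) by (simp add: \<phi>'_def add_ac)
  moreover have "\<phi> h - \<phi> 0
      = f (p + h *\<^sub>R A + h *\<^sub>R B) - f (p + h *\<^sub>R A) - f (p + h *\<^sub>R B) + f p"
    by (simp add: \<phi>_def add_ac)
  ultimately show thesis
    using that[OF near[of s t]] s t by simp
qed

text \<open>Schwarz's theorem. The second difference is symmetric in \<open>a\<close> and
  \<open>b\<close>, so the two mixed derivatives agree at some pair of points near \<open>p\<close>;
  continuity of both at \<open>p\<close> rules out a gap.\<close>

lemma smooth_on_pd_commute:
  fixes f :: "real^'k::finite \<Rightarrow> real"
  assumes S: "open S" and f: "smooth_on S f" and p: "p \<in> S"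
  shows "pd a (pd b f) p = pd b (pd a f) p"
proof (rule ccontr)
  assume ne: "pd a (pd b f) p \<noteq> pd b (pd a f) p"
  \<comment> \<open>Half of the supposed gap: two errors strictly below \<open>e\<close> cannot
    bridge a distance of \<open>2 * e\<close>.\<close>
  define e where "e = \<bar>pd a (pd b f) p - pd b (pd a f) p\<bar> / 2"
  have e: "e > 0"
    using ne by (simp add: e_def)
  have cont: "isCont (pd c (pd d f)) p" for c d
    using smooth_on_differentiable[OF S smooth_on_pd[OF smooth_on_pd[OF f]] p]
    by (rule differentiable_imp_continuous_within)
  obtain d1 where d1: "d1 > 0" "\<And>q. dist q p < d1 \<Longrightarrow> \<bar>pd a (pd b f) q - pd a (pd b f) p\<bar> < e"
    using cont[of a b] e unfolding continuous_at_eps_delta dist_real_def by blast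
  obtain d2 where d2: "d2 > 0" "\<And>q. dist q p < d2 \<Longrightarrow> \<bar>pd b (pd a f) q - pd b (pd a f) p\<bar> < e"
    using cont[of b a] e unfolding continuous_at_eps_delta dist_real_def by blast
  obtain r where r: "r > 0" "cball p r \<subseteq> S"
    using S p open_contains_cball by blast
  \<comment> \<open>Dividing by 3 keeps \<open>2 * h\<close> strictly below \<open>d1\<close> and
    \<open>d2\<close>, so the closed ball lies in both open continuity neighbourhoods.\<close>
  define h where "h = min r (min d1 d2) / 3"
  have h: "h > 0" "2 * h < d1" "2 * h < d2" "2 * h \<le> r"
    using r(1) d1(1) d2(1) by (auto simp: h_def min_def field_simps)
  then have sub: "cball p (2 * h) \<subseteq> S"
    using r(2) by (meson order_trans subset_cball)
  obtain q1 where q1: "q1 \<in> cball p (2 * h)"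
    "f (p + h *\<^sub>R axis a 1 + h *\<^sub>R axis b 1) - f (p + h *\<^sub>R axis a 1) - f (p + h *\<^sub>R axis b 1) + f p
      = h * h * pd b (pd a f) q1"
    using second_difference_mean_value[OF S f h(1) sub] by blast
  obtain q2 where q2: "q2 \<in> cball p (2 * h)"
    "f (p + h *\<^sub>R axis b 1 + h *\<^sub>R axis a 1) - f (p + h *\<^sub>R axis b 1) - f (p + h *\<^sub>R axis a 1) + f p
      = h * h * pd a (pd b f) q2"
    using second_difference_mean_value[OF S f h(1) sub] by blast
  have "h * h * pd b (pd a f) q1 = h * h * pd a (pd b f) q2"
    unfolding q1(2)[symmetric] q2(2)[symmetric] by (simp add: add_ac)
  then have "pd b (pd a f) q1 = pd a (pd b f) q2"
    using h(1) by simp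
  moreover have "\<bar>pd a (pd b f) q2 - pd a (pd b f) p\<bar> < e"
    using q2(1) h by (intro d1(2)) (simp add: dist_commute)
  moreover have "\<bar>pd b (pd a f) q1 - pd b (pd a f) p\<bar> < e"
    using q1(1) h by (intro d2(2)) (simp add: dist_commute)
  moreover have "\<bar>pd a (pd b f) p - pd b (pd a f) p\<bar> = 2 * e"
    by (simp add: e_def)
  ultimately show False
    by linarith
qed

section \<open>Matrices\<close>

lemma matrix_add_rdistrib: "((A::real^'n^'m) + B) ** C = A ** C + B ** C"
  by (simp add: matrix_matrix_mult_def vec_eq_iff distrib_right sum.distrib)

lemma matrix_diff_ldistrib: "(A::real^'n^'m) ** (B - C) = A ** B - A ** C"
  by (simp add: matrix_matrix_mult_def vec_eq_iff right_diff_distrib sum_subtractf)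

lemma matrix_diff_rdistrib: "((A::real^'n^'m) - B) ** C = A ** C - B ** C"
  by (simp add: matrix_matrix_mult_def vec_eq_iff left_diff_distrib sum_subtractf)

lemma transpose_add: "transpose (A + B) = transpose A + transpose (B::real^'n^'m)"
  by (simp add: transpose_def vec_eq_iff)

lemma transpose_diff: "transpose (A - B) = transpose A - transpose (B::real^'n^'m)"
  by (simp add: transpose_def vec_eq_iff)

lemma bounded_linear_transpose: "bounded_linear (transpose :: real^'n^'m \<Rightarrow> real^'m^'n)"
  unfolding linear_conv_bounded_linear[symmetric]
  by (rule linearI) (simp_all add: transpose_add transpose_scalar)

lemma bounded_bilinear_matrix_mult:
  "bounded_bilinear ((**) :: real^'n^'m \<Rightarrow> real^'k^'n \<Rightarrow> real^'k^'m)"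
  unfolding bilinear_conv_bounded_bilinear[symmetric] bilinear_def
  by (intro conjI allI linearI)
    (simp_all add: matrix_add_ldistrib matrix_add_rdistrib scalar_matrix_assoc matrix_scalar_ac)

lemma bounded_bilinear_matrix_vector_mult:
  "bounded_bilinear ((*v) :: real^'n^'m \<Rightarrow> real^'n \<Rightarrow> real^'m)"
  unfolding bilinear_conv_bounded_bilinear[symmetric] bilinear_def
  by (intro conjI allI linearI)
    (simp_all add: algebra_simps scaleR_matrix_vector_assoc)

lemmas differentiable_matrix_mult = differentiable_bounded_bilinear[OF bounded_bilinear_matrix_mult]
lemmas pdv_matrix_mult = pdv_bounded_bilinear[OF bounded_bilinear_matrix_mult]
lemmas differentiable_transpose = differentiable_bounded_linear[OF bounded_linear_transpose]
lemmas pdv_transpose = pdv_bounded_linear[OF bounded_linear_transpose]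
lemmas differentiable_scaleR = differentiable_bounded_bilinear[OF bounded_bilinear_scaleR]
lemmas pdv_scaleR = pdv_bounded_bilinear[OF bounded_bilinear_scaleR]

section \<open>Inverse matrices and their differentiability\<close>

lemma matrix_inv_right: "invertible A \<Longrightarrow> A ** matrix_inv A = mat 1"
  and matrix_inv_left: "invertible A \<Longrightarrow> matrix_inv A ** A = mat 1"
  for A :: "real^'n^'n"
  unfolding invertible_def matrix_inv_def by (metis (mono_tags, lifting) someI_ex)+

text \<open>Column \<open>j\<close> of the inverse solves a linear system with right-hand side
  \<open>axis j 1\<close>. Cramer's rule then gives its entries as quotients of determinants, which
  are visibly differentiable.\<close>

lemma matrix_inv_cramer:
  fixes A :: "real^'n^'n"
  assumes "invertible A"
  shows "matrix_inv A $ i $ j = det (\<chi> r c. if c = i then axis j 1 $ r else A $ r $ c) / det A"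
proof -
  have "A *v (matrix_inv A *v axis j 1) = axis j 1"
    by (simp add: matrix_vector_mul_assoc matrix_inv_right assms)
  then have "matrix_inv A *v axis j 1
      = (\<chi> k. det (\<chi> r c. if c = k then axis j 1 $ r else A $ r $ c) / det A)"
    using assms by (simp add: invertible_det_nz cramer)
  moreover have "(matrix_inv A *v axis j 1) $ i = matrix_inv A $ i $ j"
    by (simp add: matrix_vector_mult_basis column_def)
  ultimately show ?thesis
    by simp
qed

lemma differentiable_prod:
  fixes f :: "'i \<Rightarrow> 'a::real_normed_vector \<Rightarrow> real"
  assumes "\<And>i. i \<in> I \<Longrightarrow> f i differentiable at p"
  shows "(\<lambda>q. \<Prod>i\<in>I. f i q) differentiable at p"
  using assms by (induction I rule: infinite_finite_induct) auto

lemma differentiable_det: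
  fixes A :: "'a::real_normed_vector \<Rightarrow> real^'n^'n"
  assumes "\<And>i j. (\<lambda>q. A q $ i $ j) differentiable at p"
  shows "(\<lambda>q. det (A q)) differentiable at p"
  unfolding det_def
  by (intro differentiable_sum differentiable_mult differentiable_prod assms differentiable_const
      ballI finite_permutations finite)

lemma differentiable_matrix_inv:
  fixes A :: "'a::real_normed_vector \<Rightarrow> real^'n^'n"
  assumes "open S" "p \<in> S" "\<And>q. q \<in> S \<Longrightarrow> invertible (A q)" "A differentiable at p"
  shows "(\<lambda>q. matrix_inv (A q)) differentiable at p"
proof (intro differentiable_vec)
  fix i j
  have entry: "(\<lambda>q. A q $ r $ c) differentiable at p" for r c
    by (intro differentiable_vec_nth assms)
  have column_replaced:
    "(\<lambda>q. if c = i then axis j 1 $ r else A q $ r $ c) differentiable at p" for r c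
    by (cases "c = i") (simp_all add: entry)
  have "(\<lambda>q. det (\<chi> r c. if c = i then axis j 1 $ r else A q $ r $ c) / det (A q)) differentiable at p"
    using assms(2,3) column_replaced
    by (intro differentiable_divide differentiable_det) (auto simp: invertible_det_nz entry)
  then show "(\<lambda>q. matrix_inv (A q) $ i $ j) differentiable at p"
    by (rule differentiable_cong[OF assms(1,2), rotated]) (simp add: matrix_inv_cramer assms(3))
qed

text \<open>Separates the index sum of the final theorem into an ambient curvature term and two
  inner products. In each product the free index is \<open>m\<close>, and each factor has already
  absorbed its own two vectors.\<close>

lemma contract_quadratic:
  fixes c :: "'m::finite \<Rightarrow> 'm \<Rightarrow> 'm \<Rightarrow> 'm \<Rightarrow> real" and p q :: "'m \<Rightarrow> 'm \<Rightarrow> 'm \<Rightarrow> real"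
    and X Y Z V :: "real^'m"
  shows "(\<Sum>i\<in>UNIV. \<Sum>j\<in>UNIV. \<Sum>k\<in>UNIV. \<Sum>l\<in>UNIV.
      (c i j k l + (\<Sum>m\<in>UNIV. p k m i * q l m j) - (\<Sum>m\<in>UNIV. p k m j * q l m i))
      * X $ i * Y $ j * Z $ k * V $ l)
    = (\<Sum>k\<in>UNIV. \<Sum>l\<in>UNIV. Z $ k * V $ l * (X \<bullet> ((\<chi> i j. c i j k l) *v Y)))
    + (\<chi> m. \<Sum>i\<in>UNIV. \<Sum>k\<in>UNIV. p k m i * X $ i * Z $ k)
      \<bullet> (\<chi> m. \<Sum>j\<in>UNIV. \<Sum>l\<in>UNIV. q l m j * Y $ j * V $ l)
    - (\<chi> m. \<Sum>j\<in>UNIV. \<Sum>k\<in>UNIV. p k m j * Y $ j * Z $ k)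
      \<bullet> (\<chi> m. \<Sum>i\<in>UNIV. \<Sum>l\<in>UNIV. q l m i * X $ i * V $ l)" (is "?L = ?A + ?B - ?C")
proof -
  have A: "?A = (\<Sum>i\<in>UNIV. \<Sum>j\<in>UNIV. \<Sum>k\<in>UNIV. \<Sum>l\<in>UNIV. c i j k l * X $ i * Y $ j * Z $ k * V $ l)"
    unfolding inner_vec_def matrix_vector_mult_def
    by (simp add: sum_distrib_left sum_distrib_right sum.cartesian_product)
      (rule sum.reindex_bij_witness[where i = "\<lambda>(i,j,k,l). (k,l,i,j)" and j = "\<lambda>(k,l,i,j). (i,j,k,l)"],
        auto simp: mult_ac)
  \<comment> \<open>General in \<open>X\<close> and \<open>Y\<close>, because the last term is this
    one with the two vectors exchanged.\<close>
  have B: "(\<chi> m. \<Sum>i\<in>UNIV. \<Sum>k\<in>UNIV. p k m i * X $ i * Z $ k)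
      \<bullet> (\<chi> m. \<Sum>j\<in>UNIV. \<Sum>l\<in>UNIV. q l m j * Y $ j * V $ l)
      = (\<Sum>i\<in>UNIV. \<Sum>j\<in>UNIV. \<Sum>k\<in>UNIV. \<Sum>l\<in>UNIV.
        (\<Sum>m\<in>UNIV. p k m i * q l m j) * X $ i * Y $ j * Z $ k * V $ l)" for X Y :: "real^'m"
    unfolding inner_vec_def
    by (simp add: sum_product sum_distrib_left sum_distrib_right sum.cartesian_product)
      (rule sum.reindex_bij_witness[where i = "\<lambda>(i,j,k,l,m). (m,(j,l),(i,k))"
          and j = "\<lambda>(m,(j,l),(i,k)). (i,j,k,l,m)"], auto simp: mult_ac)
  have C: "?C = (\<Sum>i\<in>UNIV. \<Sum>j\<in>UNIV. \<Sum>k\<in>UNIV. \<Sum>l\<in>UNIV.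
        (\<Sum>m\<in>UNIV. p k m j * q l m i) * X $ i * Y $ j * Z $ k * V $ l)"
    unfolding B by (subst sum.swap) (simp add: mult_ac)
  show ?thesis
    unfolding A B[of X Y] C
    by (simp add: sum.distrib[symmetric] sum_subtractf[symmetric] algebra_simps)
qed

text \<open>Moves a contraction with two tangent vectors from ambient indices to parameter indices,
  ready for the pulled-back curvature.\<close>

lemma contract_image:
  fixes E :: "real^'n::finite^'m::finite" and s :: "'m \<Rightarrow> 'm \<Rightarrow> real"
  shows "(\<Sum>k\<in>UNIV. \<Sum>l\<in>UNIV. (E *v Z) $ k * (E *v V) $ l * s k l)
    = (\<Sum>a\<in>UNIV. \<Sum>b\<in>UNIV. Z $ a * V $ b * (\<Sum>k\<in>UNIV. \<Sum>l\<in>UNIV. E $ k $ a * E $ l $ b * s k l))"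
  unfolding matrix_vector_mult_def vec_lambda_beta sum_product
  by (simp add: sum_distrib_left sum_distrib_right sum.cartesian_product)
    (rule sum.reindex_bij_witness[where i = "\<lambda>(a,b,k,l). (k,l,a,b)" and j = "\<lambda>(k,l,a,b). (a,b,k,l)"],
      auto simp: mult_ac)

lemma inner_transpose_mult:
  fixes A :: "real^'n^'m"
  shows "v \<bullet> ((transpose A ** B) *v w) = (A *v v) \<bullet> (B *v w)"
  by (metis dot_lmul_matrix matrix_vector_mul_assoc transpose_matrix_vector transpose_transpose)

section \<open>Connections and their curvature\<close>

text \<open>The argument \<open>B\<close> is the action of square matrices on the values of \<open>Y\<close>, so that vector fields
  and tuples of vector fields (columns of a matrix) are treated alike.\<close>

definition nabla ::
    "(real^'m^'m \<Rightarrow> 'b \<Rightarrow> 'b) \<Rightarrow> ('k::finite \<Rightarrow> real^'k \<Rightarrow> real^'m^'m) \<Rightarrow> 'k \<Rightarrow>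
     (real^'k \<Rightarrow> 'b::real_normed_vector) \<Rightarrow> real^'k \<Rightarrow> 'b" where
  "nabla B A a Y u = pdv a Y u + B (A a u) (Y u)"

text \<open>The curvature form \<open>dA + A \<and> A\<close> of the connection
  \<open>d + A\<close>, evaluated on a pair of coordinate directions.\<close>

definition conn_curv ::
    "('k::finite \<Rightarrow> real^'k \<Rightarrow> real^'m^'m) \<Rightarrow> 'k \<Rightarrow> 'k \<Rightarrow> real^'k \<Rightarrow> real^'m^'m" where
  "conn_curv A a b u = pdv a (A b) u - pdv b (A a) u + A a u ** A b u - A b u ** A a u"

lemma differentiable_nabla:
  assumes "bounded_bilinear B" "A b differentiable at u" "Y differentiable at u"
    "pdv b Y differentiable at u"
  shows "nabla B A b Y differentiable at u"
  unfolding nabla_def[abs_def]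
  by (intro differentiable_add differentiable_bounded_bilinear[OF assms(1)] assms)

lemma nabla_commutator:
  assumes B: "bounded_bilinear B" and assoc: "\<And>P Q y. B P (B Q y) = B (P ** Q) y"
    and A: "\<And>a. A a differentiable at u" and Y: "Y differentiable at u"
    and dY: "\<And>a. pdv a Y differentiable at u" and comm: "pdv a (pdv b Y) u = pdv b (pdv a Y) u"
  shows "nabla B A a (nabla B A b Y) u - nabla B A b (nabla B A a Y) u = B (conn_curv A a b u) (Y u)"
proof -
  have "nabla B A a (nabla B A b Y) u = pdv a (pdv b Y) u + B (A b u) (pdv a Y u)
      + B (pdv a (A b) u) (Y u) + B (A a u) (pdv b Y u) + B (A a u ** A b u) (Y u)" for a b
  proof -
    have "pdv a (nabla B A b Y) u
        = pdv a (pdv b Y) u + (B (A b u) (pdv a Y u) + B (pdv a (A b) u) (Y u))"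
      unfolding nabla_def[abs_def]
      by (subst pdv_add) (simp_all add: pdv_bounded_bilinear[OF B A Y] dY
          differentiable_bounded_bilinear[OF B A Y])
    then show ?thesis
      by (simp add: nabla_def[of _ _ a] nabla_def[of _ _ b] bounded_bilinear.add_right[OF B] assoc)
  qed
  then show ?thesis
    by (simp add: comm conn_curv_def bounded_bilinear.add_left[OF B] bounded_bilinear.diff_left[OF B])
qed

section \<open>The Levi-Civita connection in matrix form\<close>

definition metric_conn ::
    "(real^'k::finite \<Rightarrow> real^'k^'k) \<Rightarrow> 'k \<Rightarrow> real^'k \<Rightarrow> real^'k^'k" where
  "metric_conn h k p = (\<chi> i l. christoffel h i k l p)"

lemma covderiv_eq_nabla:
  assumes "Y differentiable at p"
  shows "covderiv h X Y p = (\<Sum>k\<in>UNIV. X p $ k *\<^sub>R nabla (*v) (metric_conn h) k Y p)"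
  by (simp add: vec_eq_iff covderiv_def nabla_def metric_conn_def matrix_vector_mult_def pd_eq_pdv
      pdv_vec_nth[OF assms] distrib_left sum.distrib sum_distrib_left mult_ac)

lemma smooth_field_on_differentiable:
  assumes "open S" "smooth_field_on S X" "p \<in> S"
  shows "X differentiable at p"
  using assms smooth_on_differentiable unfolding smooth_field_on_def
  by (intro differentiable_vec) blast

lemma smooth_field_on_pdv:
  assumes "open S" "smooth_field_on S X" "p \<in> S"
  shows "pdv a X differentiable at p"
    and "pdv a (pdv b X) p = pdv b (pdv a X) p"
proof -
  have comp: "pdv a X q $ i = pd a (\<lambda>v. X v $ i) q" if "q \<in> S" for a i q
    using smooth_field_on_differentiable[OF assms(1,2) that] by (simp add: pd_eq_pdv pdv_vec_nth)
  have sm: "smooth_on S (\<lambda>v. X v $ i)" for i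
    using assms(2) by (simp add: smooth_field_on_def)
  have d: "(\<lambda>q. pdv a X q $ i) differentiable at p" for a i
    using smooth_on_differentiable[OF assms(1) smooth_on_pd[OF sm] assms(3)]
    by (rule differentiable_cong[OF assms(1,3), rotated]) (simp add: comp)
  then show d': "pdv a X differentiable at p" for a
    by (intro differentiable_vec)
  have "pdv a (pdv b X) p $ i = pd a (pd b (\<lambda>v. X v $ i)) p" for a b i
  proof -
    have "pdv a (pdv b X) p $ i = pdv a (\<lambda>q. pdv b X q $ i) p"
      by (simp add: pdv_vec_nth d')
    also have "\<dots> = pdv a (pd b (\<lambda>v. X v $ i)) p"
      by (rule pdv_cong[OF assms(1,3) _ d]) (simp add: comp)
    finally show ?thesis
      by (simp add: pd_eq_pdv)
  qed
  then show "pdv a (pdv b X) p = pdv b (pdv a X) p"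
    by (simp add: vec_eq_iff smooth_on_pd_commute[OF assms(1) sm assms(3), of a b])
qed

text \<open>Product rule for the coefficients of \<open>Y\<close>. The terms that differentiate
  \<open>Y\<close> are kept apart because the Lie bracket cancels them in the curvature.\<close>

lemma covderiv_covderiv:
  assumes S: "open S" "p \<in> S" and A: "\<And>k. metric_conn h k differentiable at p"
    and Y: "smooth_field_on S Y" and Z: "smooth_field_on S Z"
  shows "covderiv h X (covderiv h Y Z) p = (\<Sum>j\<in>UNIV. \<Sum>k\<in>UNIV.
      (X p $ j * pdv j Y p $ k) *\<^sub>R nabla (*v) (metric_conn h) k Z p
      + (X p $ j * Y p $ k) *\<^sub>R
        nabla (*v) (metric_conn h) j (nabla (*v) (metric_conn h) k Z) p)"
proof -
  let ?D = "\<lambda>k. nabla (*v) (metric_conn h) k Z"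
  note dY = smooth_field_on_differentiable[OF S(1) Y S(2)]
  have D: "?D k differentiable at p" for k
    by (intro differentiable_nabla bounded_bilinear_matrix_vector_mult A
        smooth_field_on_pdv(1)[OF S(1) Z S(2)] smooth_field_on_differentiable[OF S(1) Z S(2)])
  \<comment> \<open>Guaranteed only on \<open>S\<close>, where \<open>Z\<close> is differentiable,
    so the derivatives of the two sides are compared through \<open>pdv_cong\<close>.\<close>
  have eq: "(\<Sum>k\<in>UNIV. Y q $ k *\<^sub>R ?D k q) = covderiv h Y Z q" if "q \<in> S" for q
    by (simp add: covderiv_eq_nabla smooth_field_on_differentiable[OF S(1) Z that])
  have summand: "(\<lambda>q. Y q $ k *\<^sub>R ?D k q) differentiable at p" for k
    by (intro differentiable_scaleR differentiable_vec_nth dY D)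
  then have sum: "(\<lambda>q. \<Sum>k\<in>UNIV. Y q $ k *\<^sub>R ?D k q) differentiable at p"
    by (intro differentiable_sum) auto
  have "nabla (*v) (metric_conn h) j (covderiv h Y Z) p
      = (\<Sum>k\<in>UNIV. pdv j Y p $ k *\<^sub>R ?D k p + Y p $ k *\<^sub>R nabla (*v) (metric_conn h) j (?D k) p)" for j
  proof -
    have "pdv j (covderiv h Y Z) p = pdv j (\<lambda>q. \<Sum>k\<in>UNIV. Y q $ k *\<^sub>R ?D k q) p"
      by (rule pdv_cong[OF S eq sum, symmetric])
    also have "\<dots> = (\<Sum>k\<in>UNIV. Y p $ k *\<^sub>R pdv j (?D k) p + pdv j Y p $ k *\<^sub>R ?D k p)"
      by (simp add: pdv_sum[OF summand] pdv_scaleR[OF differentiable_vec_nth[OF dY] D] pdv_vec_nth[OF dY])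
    finally show ?thesis
      by (simp add: nabla_def[of _ _ j] eq[OF S(2), symmetric] bounded_bilinear.sum_right[OF bounded_bilinear_matrix_vector_mult]
          sum.distrib algebra_simps)
  qed
  then show ?thesis
    by (subst covderiv_eq_nabla[OF differentiable_cong[OF S eq sum]])
      (simp_all add: scaleR_sum_right algebra_simps)
qed

text \<open>Tensoriality: the derivatives of \<open>X\<close> and \<open>Y\<close> cancel against
  the Lie bracket term, and the commutator of derivatives of \<open>Z\<close> is given by
  \<open>nabla_commutator\<close>.\<close>

lemma curvature_eq_conn_curv:
  assumes S: "open S" "p \<in> S" and A: "\<And>k. metric_conn h k differentiable at p"
    and X: "smooth_field_on S X" and Y: "smooth_field_on S Y" and Z: "smooth_field_on S Z"
  shows "curvature h X Y Z p = (\<Sum>j\<in>UNIV. \<Sum>k\<in>UNIV.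
    (X p $ j * Y p $ k) *\<^sub>R (conn_curv (metric_conn h) j k p *v Z p))"
proof -
  let ?n = "nabla (*v) (metric_conn h)"
  note dX = smooth_field_on_differentiable[OF S(1) X S(2)]
  note dY = smooth_field_on_differentiable[OF S(1) Y S(2)]
  note dZ = smooth_field_on_differentiable[OF S(1) Z S(2)]
  have lie: "covderiv h (lie_bracket X Y) Z p
      = (\<Sum>j\<in>UNIV. \<Sum>k\<in>UNIV. (X p $ j * pdv j Y p $ k) *\<^sub>R ?n k Z p)
      - (\<Sum>j\<in>UNIV. \<Sum>k\<in>UNIV. (Y p $ j * pdv j X p $ k) *\<^sub>R ?n k Z p)"
    unfolding covderiv_eq_nabla[OF dZ] lie_bracket_def
    apply (subst (1 2) sum.swap)
    by (simp add: pd_eq_pdv pdv_vec_nth dX dY sum_subtractf scaleR_diff_left scaleR_sum_left)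
  have swap: "(\<Sum>j\<in>UNIV. \<Sum>k\<in>UNIV. (Y p $ j * X p $ k) *\<^sub>R ?n j (?n k Z) p)
      = (\<Sum>j\<in>UNIV. \<Sum>k\<in>UNIV. (X p $ j * Y p $ k) *\<^sub>R ?n k (?n j Z) p)"
    by (subst sum.swap) (simp add: mult.commute)
  have "conn_curv (metric_conn h) j k p *v Z p = ?n j (?n k Z) p - ?n k (?n j Z) p" for j k
    by (intro nabla_commutator[symmetric] bounded_bilinear_matrix_vector_mult
        matrix_vector_mul_assoc A dZ smooth_field_on_pdv[OF S(1) Z S(2)])
  then have "(\<Sum>j\<in>UNIV. \<Sum>k\<in>UNIV. (X p $ j * Y p $ k) *\<^sub>R (conn_curv (metric_conn h) j k p *v Z p))
      = (\<Sum>j\<in>UNIV. \<Sum>k\<in>UNIV. (X p $ j * Y p $ k) *\<^sub>R ?n j (?n k Z) p)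
      - (\<Sum>j\<in>UNIV. \<Sum>k\<in>UNIV. (X p $ j * Y p $ k) *\<^sub>R ?n k (?n j Z) p)"
    by (simp add: scaleR_diff_right sum_subtractf)
  then show ?thesis
    unfolding curvature_def covderiv_covderiv[OF S A Y Z] covderiv_covderiv[OF S A X Z] lie
      sum.distrib swap
    by simp
qed

text \<open>The definition of \<open>curvature4\<close> has the curvature vector in the first slot
  of \<open>form\<close>; symmetry of \<open>h p\<close> moves \<open>X\<close> to the
  front.\<close>

lemma curvature4_eq_conn_curv:
  assumes "open S" "p \<in> S" "\<And>k. metric_conn h k differentiable at p"
    and "smooth_field_on S Y" "smooth_field_on S Z" "smooth_field_on S V"
    and sym: "transpose (h p) = h p"
  shows "curvature4 h X Y Z V p = (\<Sum>k\<in>UNIV. \<Sum>l\<in>UNIV.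
    Z p $ k * V p $ l * (X p \<bullet> ((h p ** conn_curv (metric_conn h) k l p) *v Y p)))"
proof -
  have "form (h p) v w = w \<bullet> (h p *v v)" for v w
    using dot_lmul_matrix[of v "h p" w] transpose_matrix_vector[of "h p" v]
    by (simp add: form_def sym inner_commute)
  then show ?thesis
    unfolding curvature4_def curvature_eq_conn_curv[OF assms(1-3,5,6,4)]
    by (simp add: bounded_bilinear.sum_right[OF bounded_bilinear_matrix_vector_mult] inner_sum_right matrix_vector_mult_scaleR
        matrix_vector_mul_assoc)
qed

lemma smooth_on_const:
  fixes S :: "(real^'k::finite) set"
  shows "smooth_on S (\<lambda>p. c)"
proof -
  have "Ck_on r S (\<lambda>p. c)" for r c
  \<comment> \<open>The constant is generalised because the derivatives are the constant 0.\<close>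
  proof (induction r arbitrary: c)
    case (Suc r)
    have "pd i (\<lambda>p. c) = (\<lambda>p. 0)" for i :: 'k
      by (simp add: pd_def fun_eq_iff)
    then show ?case
      using Suc by simp
  qed simp
  then show ?thesis
    by (simp add: smooth_on_def)
qed

text \<open>Coordinate fields have components 0 and 1, which collapses every sum to a single
  entry.\<close>

lemma curvature_comp_eq_conn_curv:
  assumes "open S" "p \<in> S" "\<And>k. metric_conn h k differentiable at p" "transpose (h p) = h p"
  shows "curvature_comp h i j k l p = (h p ** conn_curv (metric_conn h) k l p) $ i $ j"
proof -
  have "smooth_field_on S (coord_field m)" for m
    by (simp add: smooth_field_on_def coord_field_def smooth_on_const)
  note cf = this
  show ?thesis
    unfolding curvature_comp_def
    by (subst curvature4_eq_conn_curv[OF assms(1-3) cf cf cf assms(4)])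
      (simp add: coord_field_def axis_def if_distrib[of "\<lambda>t. t * _"] if_distrib[of "\<lambda>t. _ * t"]
        inner_vec_def matrix_vector_mult_def cong: if_cong)
qed

lemma pseudo_metric_on_differentiable:
  assumes "open S" "pseudo_metric_on S h" "p \<in> S"
  shows "h differentiable at p"
  using assms smooth_on_differentiable unfolding pseudo_metric_on_def
  by (intro differentiable_vec) blast

lemma metric_conn_compatible:
  assumes "open S" "pseudo_metric_on S h" "p \<in> S"
  shows "pdv k h p = transpose (metric_conn h k p) ** h p + h p ** metric_conn h k p"
proof -
  have "h differentiable at p"
    by (rule pseudo_metric_on_differentiable[OF assms])
  then have "pdv k h p $ i $ j = pd k (\<lambda>q. h q $ i $ j) p" for i j
    by (simp add: pd_eq_pdv pdv_vec_nth differentiable_vec_nth)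
  then show ?thesis
    by (simp add: vec_eq_iff christoffel_metric[OF assms] matrix_matrix_mult_def transpose_def
        metric_conn_def mult.commute)
qed

lemma metric_conn_differentiable:
  assumes "open S" "pseudo_metric_on S h" "p \<in> S"
  shows "metric_conn h k differentiable at p"
proof (intro differentiable_vec)
  fix i j
  have "(\<lambda>q. matrix_inv (h q)) differentiable at p"
    using assms by (intro differentiable_matrix_inv[OF assms(1,3)] pseudo_metric_on_differentiable)
      (auto simp: pseudo_metric_on_def)
  moreover have "pd c (\<lambda>q. h q $ a $ b) differentiable at p" for a b c
    using assms by (intro smooth_on_differentiable[OF assms(1) smooth_on_pd])
      (auto simp: pseudo_metric_on_def)
  ultimately show "(\<lambda>q. metric_conn h k q $ i $ j) differentiable at p"
    unfolding metric_conn_def christoffel_def vec_lambda_beta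
    by (intro differentiable_mult differentiable_sum differentiable_add differentiable_diff
        differentiable_const differentiable_vec_nth ballI finite)
qed

section \<open>The Gauss equation\<close>

text \<open>Curvature commutes with pullback. The extra terms, in which a second derivative of
  \<open>x\<close> multiplies \<open>C\<close>, are symmetric in \<open>a\<close> and
  \<open>b\<close> by \<open>sym\<close> and drop out.\<close>

lemma conn_curv_pullback:
  fixes C :: "'m::finite \<Rightarrow> real^'m \<Rightarrow> real^'l^'l" and E :: "real^'n::finite \<Rightarrow> real^'n^'m"
  assumes C: "\<And>k. C k differentiable at (x u)" and x: "x differentiable at u"
    and E: "E differentiable at u" and dx: "\<And>a k. pdv a x u $ k = E u $ k $ a"
    and sym: "\<And>k. pdv a E u $ k $ b = pdv b E u $ k $ a"
  shows "conn_curv (\<lambda>a v. \<Sum>k\<in>UNIV. E v $ k $ a *\<^sub>R C k (x v)) a b u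
    = (\<Sum>k\<in>UNIV. \<Sum>l\<in>UNIV. (E u $ k $ a * E u $ l $ b) *\<^sub>R conn_curv C k l (x u))"
proof -
  have Cx: "(\<lambda>v. C k (x v)) differentiable at u" for k
    using differentiable_chain_at[OF x C, of k] by (simp add: o_def)
  have e: "(\<lambda>v. E v $ k $ a) differentiable at u" for k a
    by (intro differentiable_vec_nth E)
  have de: "pdv c (\<lambda>v. E v $ k $ a) u = pdv c E u $ k $ a" for c k a
    by (simp add: pdv_vec_nth E differentiable_vec_nth)
  have dA: "pdv a (\<lambda>v. \<Sum>l\<in>UNIV. E v $ l $ b *\<^sub>R C l (x v)) u
      = (\<Sum>l\<in>UNIV. pdv a E u $ l $ b *\<^sub>R C l (x u))
      + (\<Sum>k\<in>UNIV. \<Sum>l\<in>UNIV. (E u $ k $ a * E u $ l $ b) *\<^sub>R pdv k (C l) (x u))" for a b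
  proof -
    have "pdv a (\<lambda>v. \<Sum>l\<in>UNIV. E v $ l $ b *\<^sub>R C l (x v)) u
        = (\<Sum>l\<in>UNIV. pdv a E u $ l $ b *\<^sub>R C l (x u))
        + (\<Sum>l\<in>UNIV. \<Sum>k\<in>UNIV. (E u $ k $ a * E u $ l $ b) *\<^sub>R pdv k (C l) (x u))"
      by (subst pdv_sum) (simp_all add: differentiable_scaleR pdv_scaleR e Cx de pdv_chain[OF C x] dx
          sum.distrib scaleR_sum_right mult.commute)
    then show ?thesis
      by (subst sum.swap)
  qed
  have prod: "(\<Sum>k\<in>UNIV. E u $ k $ a *\<^sub>R C k (x u)) ** (\<Sum>l\<in>UNIV. E u $ l $ b *\<^sub>R C l (x u))
      = (\<Sum>k\<in>UNIV. \<Sum>l\<in>UNIV. (E u $ k $ a * E u $ l $ b) *\<^sub>R (C k (x u) ** C l (x u)))" for a b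
    by (simp add: bounded_bilinear.sum_left[OF bounded_bilinear_matrix_mult]
        bounded_bilinear.sum_right[OF bounded_bilinear_matrix_mult]
        bounded_bilinear.scaleR_left[OF bounded_bilinear_matrix_mult]
        bounded_bilinear.scaleR_right[OF bounded_bilinear_matrix_mult] scaleR_sum_right)
      (subst sum.swap, simp add: mult.commute)
  have swap1: "(\<Sum>k\<in>UNIV. \<Sum>l\<in>UNIV. (E u $ k $ b * E u $ l $ a) *\<^sub>R pdv k (C l) (x u))
      = (\<Sum>k\<in>UNIV. \<Sum>l\<in>UNIV. (E u $ k $ a * E u $ l $ b) *\<^sub>R pdv l (C k) (x u))"
    by (subst sum.swap) (simp add: mult.commute)
  have swap2: "(\<Sum>k\<in>UNIV. \<Sum>l\<in>UNIV. (E u $ k $ b * E u $ l $ a) *\<^sub>R (C k (x u) ** C l (x u)))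
      = (\<Sum>k\<in>UNIV. \<Sum>l\<in>UNIV. (E u $ k $ a * E u $ l $ b) *\<^sub>R (C l (x u) ** C k (x u)))"
    by (subst sum.swap) (simp add: mult.commute)
  show ?thesis
    unfolding conn_curv_def dA prod swap1 swap2 sym
    by (simp add: scaleR_diff_right scaleR_add_right sum.distrib sum_subtractf)
qed

text \<open>Collects the geometry of the immersion alone; the bracket enters later through
  \<open>bracket_D_mixed_eq\<close>.\<close>

locale submanifold =
  fixes U :: "(real^'m::finite) set" and \<eta> :: "real^'m \<Rightarrow> real^'m^'m"
    and W :: "(real^'n::finite) set" and x :: "real^'n \<Rightarrow> real^'m"
  assumes open_U: "open U" and metric: "pseudo_metric_on U \<eta>"
    and open_W: "open W" and immersion: "immersion_on W x" and image: "x ` W \<subseteq> U"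
    and nondegenerate: "u \<in> W \<Longrightarrow> invertible (induced_metric \<eta> x u)"
begin

text \<open>The columns of \<open>frame\<close> are the \<open>e\<^sub>a\<close>; column \<open>b\<close> of \<open>hess a\<close> is the ambient covariant
  derivative of \<open>e\<^sub>b\<close> along \<open>e\<^sub>a\<close>; \<open>coframe\<close> takes an ambient vector to the coefficients of its
  tangential part.\<close>

abbreviation g :: "real^'n \<Rightarrow> real^'n^'n" where
  "g \<equiv> induced_metric \<eta> x"

definition frame :: "real^'n \<Rightarrow> real^'n^'m" where
  "frame u = (\<chi> i a. pd a (\<lambda>v. x v $ i) u)"

definition pull_conn :: "'n \<Rightarrow> real^'n \<Rightarrow> real^'m^'m" where
  "pull_conn a u = (\<Sum>k\<in>UNIV. frame u $ k $ a *\<^sub>R metric_conn \<eta> k (x u))"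

definition hess :: "'n \<Rightarrow> real^'n \<Rightarrow> real^'n^'m" where
  "hess a = nabla (**) pull_conn a frame"

definition coframe :: "real^'n \<Rightarrow> real^'m^'n" where
  "coframe u = matrix_inv (g u) ** transpose (frame u) ** \<eta> (x u)"

definition normal_proj :: "real^'n \<Rightarrow> real^'m^'m" where
  "normal_proj u = mat 1 - frame u ** coframe u"

lemma push_eq_frame: "push x u \<xi> = frame u *v \<xi>"
  by (simp add: push_def frame_def tangent_basis_def vec_eq_iff matrix_vector_mult_def mult.commute)

lemma g_eq_frame: "g u = transpose (frame u) ** \<eta> (x u) ** frame u"
proof -
  have "g u $ a $ b = (transpose (frame u) ** (\<eta> (x u) ** frame u)) $ a $ b" for a b
    by (simp add: induced_metric_def form_def frame_def tangent_basis_def inner_vec_def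
        matrix_vector_mult_def matrix_matrix_mult_def transpose_def)
  then show ?thesis
    by (simp add: vec_eq_iff matrix_mul_assoc)
qed

lemma x_smooth: "smooth_on W (\<lambda>v. x v $ i)"
  using immersion by (simp add: immersion_on_def smooth_field_on_def)

lemma frame_entry: "(\<lambda>v. frame v $ i $ a) = pd a (\<lambda>v. x v $ i)"
  by (simp add: frame_def)

lemma pdv_frame_eq_hess: "pdv a frame u = hess a u - pull_conn a u ** frame u"
  by (simp add: hess_def nabla_def)

context
  fixes u assumes u: "u \<in> W"
begin

lemma x_in_U: "x u \<in> U"
  using u image by blast

lemma x_differentiable: "x differentiable at u"
  by (intro differentiable_vec smooth_on_differentiable[OF open_W x_smooth u])

lemma pdv_x: "pdv a x u $ k = frame u $ k $ a"
  by (simp add: frame_def pd_eq_pdv pdv_vec_nth x_differentiable)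

lemma frame_differentiable: "frame differentiable at u"
  by (intro differentiable_vec)
    (simp add: frame_entry smooth_on_differentiable[OF open_W smooth_on_pd[OF x_smooth] u])

lemma pdv_frame: "pdv b frame u $ i $ a = pd b (pd a (\<lambda>v. x v $ i)) u"
  by (simp add: pd_eq_pdv[of b] frame_entry[symmetric] pdv_vec_nth frame_differentiable
      differentiable_vec_nth)

lemma pdv_frame_sym: "pdv b frame u $ i $ a = pdv a frame u $ i $ b"
  by (simp add: pdv_frame smooth_on_pd_commute[OF open_W x_smooth u, of a b])

end

context
  fixes u assumes u: "u \<in> W"
begin

text \<open>Differentiates the identity \<open>pdv_frame\<close>, which must therefore be available
  at all points near \<open>u\<close>. This is why the preceding context was closed and a new one
  opened.\<close>

lemma pdv_frame_entry_differentiable: "(\<lambda>v. pdv b frame v $ i $ a) differentiable at u"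
  using smooth_on_differentiable[OF open_W smooth_on_pd[OF smooth_on_pd[OF x_smooth]] u]
  by (rule differentiable_cong[OF open_W u, rotated]) (simp add: pdv_frame)

lemma pdv_frame_differentiable: "pdv b frame differentiable at u"
  by (intro differentiable_vec pdv_frame_entry_differentiable)

lemma pdv_pdv_frame_commute: "pdv a (pdv b frame) u = pdv b (pdv a frame) u"
proof -
  have "pdv a (pdv b frame) u $ i $ f = pd a (pd b (pd f (\<lambda>v. x v $ i))) u" for a b i f
  proof -
    have "pdv a (pdv b frame) u $ i $ f = pdv a (\<lambda>v. pdv b frame v $ i $ f) u"
      by (simp add: pdv_vec_nth pdv_frame_differentiable differentiable_vec_nth)
    also have "\<dots> = pdv a (pd b (pd f (\<lambda>v. x v $ i))) u"
      by (rule pdv_cong[OF open_W u _ pdv_frame_entry_differentiable]) (simp add: pdv_frame)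
    finally show ?thesis
      by (simp add: pd_eq_pdv)
  qed
  then show ?thesis
    by (simp add: vec_eq_iff
        smooth_on_pd_commute[OF open_W smooth_on_pd[OF x_smooth] u, of a b])
qed

lemma metric_conn_at_x_differentiable: "metric_conn \<eta> k differentiable at (x u)"
  by (rule metric_conn_differentiable[OF open_U metric x_in_U[OF u]])

lemma pull_conn_differentiable: "pull_conn a differentiable at u"
proof -
  have "(\<lambda>v. metric_conn \<eta> k (x v)) differentiable at u" for k
    using differentiable_chain_at[OF x_differentiable[OF u] metric_conn_at_x_differentiable]
    by (simp add: o_def)
  then show ?thesis
    unfolding pull_conn_def[abs_def]
    by (intro differentiable_sum differentiable_scaleR differentiable_vec_nth
        frame_differentiable[OF u] finite ballI)
qed

lemma hess_differentiable: "hess a differentiable at u"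
  unfolding hess_def
  by (intro differentiable_nabla bounded_bilinear_matrix_mult pull_conn_differentiable
      frame_differentiable[OF u] pdv_frame_differentiable)

text \<open>The derivative part is symmetric because second partials of \<open>x\<close> commute,
  the connection part because the ambient connection is torsion-free.\<close>

lemma hess_sym: "hess a u $ i $ b = hess b u $ i $ a"
proof -
  have "(pull_conn a u ** frame u) $ i $ b
      = (\<Sum>l\<in>UNIV. \<Sum>k\<in>UNIV. frame u $ k $ a * (christoffel \<eta> i k l (x u) * frame u $ l $ b))" for a b
    by (simp add: matrix_matrix_mult_def pull_conn_def metric_conn_def sum_distrib_right mult.assoc)
  then have "(pull_conn a u ** frame u) $ i $ b = (pull_conn b u ** frame u) $ i $ a"
    by (simp only:) (subst sum.swap,
      simp add: christoffel_torsion_free[OF open_U metric x_in_U[OF u], of i] mult_ac)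
  then show ?thesis
    by (simp add: hess_def nabla_def pdv_frame_sym[OF u, of a i b])
qed

section \<open>The induced metric and its derivative\<close>

lemma eta_differentiable: "(\<lambda>v. \<eta> (x v)) differentiable at u"
  using differentiable_chain_at[OF x_differentiable[OF u]
      pseudo_metric_on_differentiable[OF open_U metric x_in_U[OF u]]] by (simp add: o_def)

text \<open>The ambient metric along the submanifold is parallel for the pulled-back connection: the
  chain rule applied to \<open>metric_conn_compatible\<close>.\<close>

lemma pdv_eta: "pdv a (\<lambda>v. \<eta> (x v)) u
    = transpose (pull_conn a u) ** \<eta> (x u) + \<eta> (x u) ** pull_conn a u"
  by (simp add: pdv_chain x_differentiable[OF u] pdv_x[OF u]
      pseudo_metric_on_differentiable[OF open_U metric x_in_U[OF u]]
      metric_conn_compatible[OF open_U metric x_in_U[OF u]] pull_conn_def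
      bounded_bilinear.sum_left[OF bounded_bilinear_matrix_mult]
      bounded_bilinear.sum_right[OF bounded_bilinear_matrix_mult]
      bounded_bilinear.scaleR_left[OF bounded_bilinear_matrix_mult]
      bounded_bilinear.scaleR_right[OF bounded_bilinear_matrix_mult]
      linear_sum[OF bounded_linear.linear[OF bounded_linear_transpose]] transpose_scalar scaleR_add_right sum.distrib)

lemma eta_sym: "transpose (\<eta> (x u)) = \<eta> (x u)"
  using metric x_in_U[OF u] by (simp add: pseudo_metric_on_def)

lemma g_sym: "transpose (g u) = g u"
  by (simp add: g_eq_frame matrix_transpose_mul eta_sym matrix_mul_assoc)

lemma g_differentiable: "g differentiable at u"
  unfolding g_eq_frame[abs_def]
  by (intro differentiable_matrix_mult differentiable_transpose frame_differentiable[OF u]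
      eta_differentiable)

text \<open>Metric product rule for the pairing of the \<open>e\<^sub>c\<close> with the columns of
  \<open>M\<close>. The transposed connection term from the frame cancels against the one in
  \<open>pdv_eta\<close>; the other one completes the derivative of \<open>M\<close> to
  \<open>nabla\<close>.\<close>

lemma pdv_transpose_frame_eta_mult:
  assumes "M differentiable at u"
  shows "pdv a (\<lambda>v. transpose (frame v) ** \<eta> (x v) ** M v) u
    = transpose (hess a u) ** \<eta> (x u) ** M u
    + transpose (frame u) ** \<eta> (x u) ** nabla (**) pull_conn a M u"
proof -
  have "pdv a (\<lambda>v. transpose (frame v)) u
      = transpose (hess a u) - transpose (frame u) ** transpose (pull_conn a u)"
    by (simp add: pdv_transpose frame_differentiable[OF u] pdv_frame_eq_hess transpose_diff
        matrix_transpose_mul)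
  then show ?thesis
    by (simp add: pdv_matrix_mult differentiable_matrix_mult differentiable_transpose assms
        frame_differentiable[OF u] eta_differentiable pdv_eta nabla_def matrix_add_ldistrib
        matrix_add_rdistrib matrix_diff_rdistrib matrix_mul_assoc)
qed

lemma pdv_g: "pdv a g u
    = transpose (hess a u) ** \<eta> (x u) ** frame u + transpose (frame u) ** \<eta> (x u) ** hess a u"
  using pdv_transpose_frame_eta_mult[OF frame_differentiable[OF u]]
  by (simp add: g_eq_frame[abs_def] hess_def)

section \<open>Tangential and normal projections\<close>

lemma g_inv: "g u ** matrix_inv (g u) = mat 1" "matrix_inv (g u) ** g u = mat 1"
  using nondegenerate[OF u] by (simp_all add: matrix_inv_right matrix_inv_left)

lemma g_coframe: "g u ** coframe u = transpose (frame u) ** \<eta> (x u)"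
  by (simp add: coframe_def matrix_mul_assoc g_inv)

lemma coframe_frame: "coframe u ** frame u = mat 1"
  using g_inv(2) by (simp add: coframe_def g_eq_frame matrix_mul_assoc)

lemma normal_proj_frame: "normal_proj u ** frame u = 0"
  by (simp add: normal_proj_def matrix_diff_rdistrib matrix_mul_assoc[symmetric] coframe_frame)

lemma coframe_differentiable: "coframe differentiable at u"
  unfolding coframe_def[abs_def]
  by (intro differentiable_matrix_mult differentiable_transpose frame_differentiable[OF u]
      eta_differentiable differentiable_matrix_inv[OF open_W u nondegenerate] g_differentiable)

lemma normal_proj_differentiable: "normal_proj differentiable at u"
  unfolding normal_proj_def[abs_def]
  by (intro differentiable_diff differentiable_const differentiable_matrix_mult
      frame_differentiable[OF u] coframe_differentiable)

text \<open>The Gauss formula, obtained from Koszul's.\<close>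

lemma metric_conn_g: "metric_conn g b u = coframe u ** hess b u"
proof -
  \<comment> \<open>The entry \<open>K b $ c $ f\<close> pairs \<open>e\<^sub>c\<close> with the
    ambient derivative of \<open>e\<^sub>f\<close> along \<open>e\<^sub>b\<close>. These turn out to
    be the Christoffel symbols of the first kind of \<open>g\<close>.\<close>
  define K where "K b = transpose (frame u) ** \<eta> (x u) ** hess b u" for b
  have "K b $ c $ f = (\<Sum>i\<in>UNIV. (transpose (frame u) ** \<eta> (x u)) $ c $ i * hess b u $ i $ f)" for b c f
    by (simp add: K_def matrix_matrix_mult_def)
  then have Ksym: "K b $ c $ f = K f $ c $ b" for b c f
    by (simp add: hess_sym[of b _ f])
  have KT: "transpose (hess b u) ** \<eta> (x u) ** frame u = transpose (K b)" for b
    by (simp add: K_def matrix_transpose_mul eta_sym matrix_mul_assoc)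
  have dg: "pd b (\<lambda>v. g v $ c $ f) u = K b $ f $ c + K b $ c $ f" for b c f
  proof -
    have "pd b (\<lambda>v. g v $ c $ f) u = pdv b g u $ c $ f"
      by (simp add: pd_eq_pdv pdv_vec_nth g_differentiable differentiable_vec_nth)
    also have "pdv b g u = transpose (K b) + K b"
      by (simp add: pdv_g KT) (simp add: K_def)
    finally show ?thesis
      by (simp add: transpose_def)
  qed
  \<comment> \<open>Koszul's combination: of the six terms, symmetry of \<open>K\<close> in the
    first and last index cancels four and identifies the remaining two.\<close>
  have "pd b (\<lambda>v. g v $ c $ f) u + pd f (\<lambda>v. g v $ c $ b) u - pd c (\<lambda>v. g v $ b $ f) u
      = 2 * K b $ c $ f" for b c f
    unfolding dg using Ksym[of f c b] Ksym[of b f c] Ksym[of f b c] by simp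
  then have "christoffel g d b f u = (matrix_inv (g u) ** K b) $ d $ f" for d f
    unfolding christoffel_def
    by (simp add: matrix_matrix_mult_def sum_distrib_left)
  then show ?thesis
    by (simp add: vec_eq_iff metric_conn_def K_def coframe_def matrix_mul_assoc)
qed

end

context
  fixes u assumes u: "u \<in> W"
begin

text \<open>The Gauss formula supplies differentiability directly, without first establishing that
  the entries of \<open>g\<close> are smooth.\<close>

lemma metric_conn_g_differentiable: "metric_conn g b differentiable at u"
proof (rule differentiable_cong[OF open_W u])
  show "(\<lambda>v. coframe v ** hess b v) differentiable at u"
    by (intro differentiable_matrix_mult coframe_differentiable hess_differentiable u)
qed (simp add: metric_conn_g)

lemma gauss_equation:
  "g u ** conn_curv (metric_conn g) a b u
    = transpose (frame u) ** \<eta> (x u) ** conn_curv pull_conn a b u ** frame u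
    + transpose (hess a u) ** \<eta> (x u) ** normal_proj u ** hess b u
    - transpose (hess b u) ** \<eta> (x u) ** normal_proj u ** hess a u"
proof -
  let ?C = "metric_conn g" and ?E = "frame u" and ?H = "\<eta> (x u)"
  have gC: "g v ** ?C b v = transpose (frame v) ** \<eta> (x v) ** hess b v" if "v \<in> W" for v b
    by (simp add: metric_conn_g[OF that] matrix_mul_assoc g_coframe[OF that])
  \<comment> \<open>One order of differentiation; subtracting the same identity with
    \<open>a\<close> and \<open>b\<close> exchanged yields the curvature on both sides.\<close>
  have "g u ** pdv a (?C b) u + g u ** ?C a u ** ?C b u
      = transpose ?E ** ?H ** nabla (**) pull_conn a (hess b) u
      + transpose (hess a u) ** ?H ** normal_proj u ** hess b u" for a b
  proof -
    have "g u ** pdv a (?C b) u + pdv a g u ** ?C b u = pdv a (\<lambda>v. g v ** ?C b v) u"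
      by (rule pdv_matrix_mult[OF g_differentiable[OF u] metric_conn_g_differentiable, symmetric])
    also have "\<dots> = pdv a (\<lambda>v. transpose (frame v) ** \<eta> (x v) ** hess b v) u"
      by (rule pdv_cong[OF open_W u gC])
        (simp_all add: differentiable_matrix_mult g_differentiable[OF u] metric_conn_g_differentiable)
    also have "\<dots> = transpose (hess a u) ** ?H ** hess b u
        + transpose ?E ** ?H ** nabla (**) pull_conn a (hess b) u"
      by (rule pdv_transpose_frame_eta_mult[OF u hess_differentiable[OF u]])
    finally have "g u ** pdv a (?C b) u = transpose (hess a u) ** ?H ** hess b u
        + transpose ?E ** ?H ** nabla (**) pull_conn a (hess b) u - pdv a g u ** ?C b u"
      by (simp add: algebra_simps)
    \<comment> \<open>The first summand of \<open>pdv a g\<close> removes the tangential part of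
      \<open>hess b\<close>, leaving \<open>normal_proj\<close>; the second supplies the quadratic
      term of \<open>conn_curv\<close>.\<close>
    moreover have "pdv a g u ** ?C b u
        = transpose (hess a u) ** ?H ** ?E ** coframe u ** hess b u + g u ** ?C a u ** ?C b u"
      by (simp add: gC[OF u] pdv_g[OF u] matrix_add_rdistrib)
        (simp add: metric_conn_g[OF u] matrix_mul_assoc)
    ultimately show ?thesis
      by (simp add: normal_proj_def matrix_diff_ldistrib matrix_diff_rdistrib matrix_mul_assoc)
  qed
  note key = this
  \<comment> \<open>Since \<open>hess\<close> is itself a covariant derivative of the frame, the
    antisymmetrized second derivative is ambient curvature.\<close>
  have "nabla (**) pull_conn a (hess b) u - nabla (**) pull_conn b (hess a) u
      = conn_curv pull_conn a b u ** ?E"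
    unfolding hess_def
    by (intro nabla_commutator bounded_bilinear_matrix_mult matrix_mul_assoc
        pull_conn_differentiable[OF u] frame_differentiable[OF u] pdv_frame_differentiable[OF u]
        pdv_pdv_frame_commute[OF u])
  moreover have "g u ** conn_curv ?C a b u
      = (g u ** pdv a (?C b) u + g u ** ?C a u ** ?C b u)
      - (g u ** pdv b (?C a) u + g u ** ?C b u ** ?C a u)"
    by (simp add: conn_curv_def matrix_add_ldistrib matrix_diff_ldistrib matrix_mul_assoc)
  ultimately show ?thesis
    by (simp add: key diff_eq_eq matrix_add_ldistrib matrix_mul_assoc)
qed

lemma conn_curv_pull_conn:
  "conn_curv pull_conn a b u = (\<Sum>k\<in>UNIV. \<Sum>l\<in>UNIV.
     (frame u $ k $ a * frame u $ l $ b) *\<^sub>R conn_curv (metric_conn \<eta>) k l (x u))"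
  unfolding pull_conn_def[abs_def]
  by (intro conn_curv_pullback metric_conn_at_x_differentiable x_differentiable
      frame_differentiable pdv_x pdv_frame_sym u)

end

end

section \<open>The derivative of the normal projection\<close>

context submanifold
begin

section \<open>Covariant derivatives in tangent directions\<close>

lemma christoffel_frame:
  "(\<Sum>l\<in>UNIV. (frame u *v \<zeta>) $ l * christoffel \<eta> i l k (x u))
    = (\<Sum>a\<in>UNIV. \<zeta> $ a *\<^sub>R pull_conn a u) $ i $ k"
  by (simp add: matrix_vector_mult_def pull_conn_def metric_conn_def sum_distrib_left
      sum_distrib_right mult_ac) (rule sum.swap)

context
  fixes u assumes u: "u \<in> W"
begin

text \<open>Injectivity of \<open>push x u\<close> makes the definite description pick exactly
  \<open>\<zeta>\<close>.\<close>

lemma tangent_deriv_frame: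
  "tangent_deriv x u (frame u *v \<zeta>) f = (\<Sum>a\<in>UNIV. \<zeta> $ a * pd a f u)"
proof -
  have "inj (push x u)"
    using immersion u by (simp add: immersion_on_def)
  then have "(THE \<xi>. push x u \<xi> = frame u *v \<zeta>) = \<zeta>"
    by (intro the_equality) (auto simp: push_eq_frame inj_def)
  then show ?thesis
    by (simp add: tangent_deriv_def)
qed

text \<open>The upper index contributes a left and the lower index a right multiplication by the
  connection matrix.\<close>

lemma covderiv_up_low_frame:
  assumes T: "T differentiable at u"
  shows "covderiv_up_low \<eta> x u (frame u *v \<zeta>) T i j
    = (\<Sum>a\<in>UNIV. \<zeta> $ a *\<^sub>R (pdv a T u + pull_conn a u ** T u - T u ** pull_conn a u)) $ i $ j"
proof -
  let ?G = "\<Sum>a\<in>UNIV. \<zeta> $ a *\<^sub>R pull_conn a u"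
  have 1: "(\<Sum>l\<in>UNIV. \<Sum>k\<in>UNIV. (frame u *v \<zeta>) $ l * christoffel \<eta> i l k (x u) * T u $ k $ j)
      = (?G ** T u) $ i $ j"
    by (subst sum.swap)
      (simp only: matrix_matrix_mult_def vec_lambda_beta christoffel_frame[symmetric] sum_distrib_right)
  have 2: "(\<Sum>l\<in>UNIV. \<Sum>k\<in>UNIV. (frame u *v \<zeta>) $ l * christoffel \<eta> k l j (x u) * T u $ i $ k)
      = (T u ** ?G) $ i $ j"
    by (subst sum.swap, simp only: matrix_matrix_mult_def vec_lambda_beta
        christoffel_frame[symmetric] sum_distrib_left) (simp add: mult_ac)
  have 3: "pd a (\<lambda>v. T v $ i $ j) u = pdv a T u $ i $ j" for a
    by (simp add: pd_eq_pdv pdv_vec_nth T differentiable_vec_nth)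
  show ?thesis
    unfolding covderiv_up_low_def tangent_deriv_frame 1 2 3
    by (simp add: bounded_bilinear.sum_left[OF bounded_bilinear_matrix_mult]
        bounded_bilinear.sum_right[OF bounded_bilinear_matrix_mult]
        bounded_bilinear.scaleR_left[OF bounded_bilinear_matrix_mult]
        bounded_bilinear.scaleR_right[OF bounded_bilinear_matrix_mult]
        distrib_left right_diff_distrib sum.distrib sum_subtractf)
qed

text \<open>Lowering the first index replaces left multiplication by the connection with left
  multiplication by minus its transpose.\<close>

lemma covderiv_low_low_frame:
  assumes T: "T differentiable at u"
  shows "covderiv_low_low \<eta> x u (frame u *v \<zeta>) T i j
    = (\<Sum>a\<in>UNIV. \<zeta> $ a *\<^sub>R
        (pdv a T u - transpose (pull_conn a u) ** T u - T u ** pull_conn a u)) $ i $ j"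
proof -
  let ?G = "\<Sum>a\<in>UNIV. \<zeta> $ a *\<^sub>R pull_conn a u"
  have tG: "transpose ?G = (\<Sum>a\<in>UNIV. \<zeta> $ a *\<^sub>R transpose (pull_conn a u))"
    by (simp add: linear_sum[OF bounded_linear.linear[OF bounded_linear_transpose]] transpose_scalar)
  have 1: "(\<Sum>l\<in>UNIV. \<Sum>k\<in>UNIV. (frame u *v \<zeta>) $ l * christoffel \<eta> k l i (x u) * T u $ k $ j)
      = (transpose ?G ** T u) $ i $ j"
    by (subst sum.swap)
      (simp only: matrix_matrix_mult_def transpose_def vec_lambda_beta christoffel_frame[symmetric]
        sum_distrib_right)
  have 2: "(\<Sum>l\<in>UNIV. \<Sum>k\<in>UNIV. (frame u *v \<zeta>) $ l * christoffel \<eta> k l j (x u) * T u $ i $ k)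
      = (T u ** ?G) $ i $ j"
    by (subst sum.swap, simp only: matrix_matrix_mult_def vec_lambda_beta
        christoffel_frame[symmetric] sum_distrib_left) (simp add: mult_ac)
  have 3: "pd a (\<lambda>v. T v $ i $ j) u = pdv a T u $ i $ j" for a
    by (simp add: pd_eq_pdv pdv_vec_nth T differentiable_vec_nth)
  show ?thesis
    unfolding covderiv_low_low_def tangent_deriv_frame 1 2 3 tG
    by (simp add: bounded_bilinear.sum_left[OF bounded_bilinear_matrix_mult]
        bounded_bilinear.sum_right[OF bounded_bilinear_matrix_mult]
        bounded_bilinear.scaleR_left[OF bounded_bilinear_matrix_mult]
        bounded_bilinear.scaleR_right[OF bounded_bilinear_matrix_mult]
        right_diff_distrib sum_subtractf)
qed

text \<open>Differentiates \<open>T ** frame = 0\<close>. The left factor \<open>M\<close> may be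
  arbitrary because \<open>M ** T\<close> still annihilates the frame, so the same identity serves
  both index positions of the first slot.\<close>

lemma pdv_annihilator:
  assumes T: "T differentiable at u" and zero: "\<And>v. v \<in> W \<Longrightarrow> T v ** frame v = 0"
  shows "(pdv a T u + M ** T u - T u ** pull_conn a u) ** frame u = - (T u ** hess a u)"
proof -
  have "pdv a (\<lambda>v. T v ** frame v) u = pdv a (\<lambda>v. 0) u"
    by (rule pdv_cong[OF open_W u zero])
      (simp_all add: differentiable_matrix_mult T frame_differentiable[OF u])
  then have "pdv a T u ** frame u = - (T u ** pdv a frame u)"
    by (simp add: pdv_matrix_mult T frame_differentiable[OF u] add_eq_0_iff)
  then show ?thesis
    by (simp add: pdv_frame_eq_hess matrix_add_rdistrib matrix_diff_rdistrib
        matrix_diff_ldistrib matrix_mul_assoc)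
      (simp add: matrix_mul_assoc[symmetric] zero[OF u])
qed

text \<open>The projection is orthogonal: \<open>\<eta>\<close> times \<open>normal_proj\<close> is
  symmetric because the inverse of \<open>g\<close> is, and \<open>normal_proj\<close> is idempotent
  because it kills the frame, as is seen by expanding its right-hand factor.\<close>

lemma normal_proj_inner:
  "(\<eta> (x u) ** normal_proj u *v w) \<bullet> (normal_proj u *v w')
    = w \<bullet> (\<eta> (x u) ** normal_proj u *v w')"
  and normal_proj_form_sym:
  "w \<bullet> (\<eta> (x u) ** normal_proj u *v w') = w' \<bullet> (\<eta> (x u) ** normal_proj u *v w)"
proof -
  let ?P = "normal_proj u" and ?H = "\<eta> (x u)"
  have "transpose (matrix_inv (g u)) = matrix_inv (g u)"
  proof -
    have "transpose (matrix_inv (g u)) ** g u = mat 1"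
      using arg_cong[OF g_inv(1)[OF u], of transpose]
      by (simp add: matrix_transpose_mul g_sym[OF u] transpose_mat)
    then have "transpose (matrix_inv (g u)) ** (g u ** matrix_inv (g u)) = matrix_inv (g u)"
      by (simp add: matrix_mul_assoc)
    then show ?thesis
      by (simp add: g_inv(1)[OF u])
  qed
  then have sym: "transpose (?H ** ?P) = ?H ** ?P"
    by (simp add: normal_proj_def coframe_def matrix_transpose_mul eta_sym[OF u] transpose_diff
        transpose_mat matrix_diff_ldistrib matrix_diff_rdistrib matrix_mul_assoc)
  have idem: "?P ** ?P = ?P"
    by (subst (2) normal_proj_def)
      (simp add: matrix_diff_ldistrib matrix_mul_assoc normal_proj_frame[OF u])
  have "v \<bullet> (transpose (?H ** ?P) *v v') = (?H ** ?P *v v) \<bullet> v'" for v v'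
    by (metis dot_lmul_matrix transpose_matrix_vector transpose_transpose)
  note adj = this
  show "w \<bullet> (?H ** ?P *v w') = w' \<bullet> (?H ** ?P *v w)"
    using adj[of w w'] unfolding sym by (simp only: inner_commute)
  have "(?H ** ?P *v w) \<bullet> (?P *v w') = w \<bullet> (transpose (?H ** ?P) *v (?P *v w'))"
    by (simp only: adj)
  also have "\<dots> = w \<bullet> (?H ** (?P ** ?P) *v w')"
    unfolding sym by (simp add: matrix_vector_mul_assoc matrix_mul_assoc)
  finally show "(?H ** ?P *v w) \<bullet> (?P *v w') = w \<bullet> (?H ** ?P *v w')"
    by (simp add: idem)
qed

end

text \<open>The factors \<open>\<epsilon>\<close> and \<open>\<gamma>\<close> cancel because
  \<open>\<epsilon> * \<epsilon> = 1\<close> and \<open>\<gamma> u\<close> is nonzero. Lowering an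
  index then turns the bracket expression into the tangential projection.\<close>

lemma bracket_D_mixed_eq:
  assumes "bracket_compatible_on W br N \<eta> x \<epsilon> \<gamma>" "\<epsilon> \<in> {-1, 1}" "u \<in> W" "\<gamma> u > 0"
  shows "bracket_D_mixed br N \<eta> x \<epsilon> \<gamma> u = frame u ** coframe u"
proof -
  have "\<epsilon> * \<epsilon> = 1"
    using assms(2) by auto
  then have sc: "\<epsilon> / (\<gamma> u)\<^sup>2 * (\<epsilon> * (\<gamma> u)\<^sup>2 * s) = s" for s
    using assms(4) by (simp add: field_simps)
  have "bracket_D br N \<eta> x \<epsilon> \<gamma> u $ i $ j
      = (\<Sum>a\<in>UNIV. \<Sum>b\<in>UNIV. frame u $ i $ a * (matrix_inv (g u) $ a $ b * frame u $ j $ b))" for i j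
    using assms(1,3)
    by (simp only: bracket_D_def bracket_compatible_on_def vector_scaleR_component real_scaleR_def sc)
      (simp add: frame_def mult_ac)
  then have "bracket_D br N \<eta> x \<epsilon> \<gamma> u = frame u ** (matrix_inv (g u) ** transpose (frame u))"
    by (simp add: vec_eq_iff matrix_matrix_mult_def transpose_def sum_distrib_left)
  then show ?thesis
    by (simp add: bracket_D_mixed_def coframe_def matrix_mul_assoc)
qed

text \<open>\<open>ambient_hess u \<zeta> \<xi>\<close> is \<open>\<zeta>\<^sup>a \<xi>\<^sup>b\<close> times the ambient covariant derivative of \<open>e\<^sub>b\<close> along \<open>e\<^sub>a\<close>;
  its normal part is the second fundamental form.\<close>

definition ambient_hess :: "real^'n \<Rightarrow> real^'n \<Rightarrow> real^'n \<Rightarrow> real^'m" where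
  "ambient_hess u \<zeta> \<xi> = (\<Sum>a\<in>UNIV. \<zeta> $ a *\<^sub>R (hess a u *v \<xi>))"

section \<open>The Gauss equation contracted with tangent fields\<close>

lemma ambient_hess_inner:
  "ambient_hess u \<zeta> \<xi> \<bullet> (M *v ambient_hess u \<nu> \<theta>)
    = (\<Sum>a\<in>UNIV. \<Sum>b\<in>UNIV. \<zeta> $ a * \<nu> $ b * ((hess a u *v \<xi>) \<bullet> (M *v (hess b u *v \<theta>))))"
  by (simp add: ambient_hess_def bounded_bilinear.sum_right[OF bounded_bilinear_matrix_vector_mult]
      inner_sum_left inner_sum_right matrix_vector_mult_scaleR sum_distrib_left mult_ac)
    (rule sum.swap)

context
  fixes u assumes u: "u \<in> W"
begin

text \<open>Contracts \<open>gauss_equation\<close> with the four fields. The ambient curvature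
  becomes that of the pulled-back connection by \<open>contract_image\<close> and
  \<open>conn_curv_pull_conn\<close>.\<close>

lemma curvature4_gauss:
  assumes "smooth_field_on W Y" "smooth_field_on W Z" "smooth_field_on W V"
  shows "curvature4 g X Y Z V u
    = (\<Sum>k\<in>UNIV. \<Sum>l\<in>UNIV. push x u (Z u) $ k * push x u (V u) $ l *
        (push x u (X u) \<bullet> ((\<chi> i j. curvature_comp \<eta> i j k l (x u)) *v push x u (Y u))))
    + ambient_hess u (Z u) (X u) \<bullet> ((\<eta> (x u) ** normal_proj u) *v ambient_hess u (V u) (Y u))
    - ambient_hess u (Z u) (Y u) \<bullet> ((\<eta> (x u) ** normal_proj u) *v ambient_hess u (V u) (X u))"
proof -
  let ?F = "\<lambda>k l. conn_curv (metric_conn \<eta>) k l (x u)" and ?HP = "\<eta> (x u) ** normal_proj u"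
  let ?E = "frame u"
  have "curvature_comp \<eta> i j k l (x u) = (\<eta> (x u) ** ?F k l) $ i $ j" for i j k l
    by (rule curvature_comp_eq_conn_curv[OF open_U x_in_U[OF u]
          metric_conn_at_x_differentiable[OF u] eta_sym[OF u]])
  then have comp: "(\<chi> i j. curvature_comp \<eta> i j k l (x u)) = \<eta> (x u) ** ?F k l" for k l
    by (simp add: vec_eq_iff)
  have ambient: "(\<Sum>k\<in>UNIV. \<Sum>l\<in>UNIV. (?E *v Z u) $ k * (?E *v V u) $ l *
        ((?E *v X u) \<bullet> ((\<eta> (x u) ** ?F k l) *v (?E *v Y u))))
      = (\<Sum>a\<in>UNIV. \<Sum>b\<in>UNIV. Z u $ a * V u $ b *
        ((?E *v X u) \<bullet> ((\<eta> (x u) ** conn_curv pull_conn a b u) *v (?E *v Y u))))"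
    unfolding contract_image conn_curv_pull_conn[OF u]
    by (simp add: bounded_bilinear.sum_left[OF bounded_bilinear_matrix_vector_mult]
        bounded_bilinear.scaleR_left[OF bounded_bilinear_matrix_vector_mult]
        bounded_bilinear.sum_right[OF bounded_bilinear_matrix_mult]
        bounded_bilinear.scaleR_right[OF bounded_bilinear_matrix_mult]
        inner_sum_right)
  \<comment> \<open>In \<open>gauss_equation\<close> the second extrinsic term has
    \<open>hess b\<close> acting on \<open>X\<close>; symmetry of the normal form exchanges the two
    arguments while \<open>a\<close> stays with \<open>Z\<close> and \<open>b\<close> with
    \<open>V\<close>.\<close>
  have flip: "ambient_hess u (Z u) (Y u) \<bullet> (?HP *v ambient_hess u (V u) (X u))
      = (\<Sum>a\<in>UNIV. \<Sum>b\<in>UNIV. Z u $ a * V u $ b *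
          ((hess b u *v X u) \<bullet> (?HP *v (hess a u *v Y u))))"
    unfolding ambient_hess_inner
    by (intro sum.cong refl arg_cong2[where f = "(*)"] normal_proj_form_sym[OF u])
  have entry: "X u \<bullet> ((g u ** conn_curv (metric_conn g) a b u) *v Y u)
      = (?E *v X u) \<bullet> ((\<eta> (x u) ** conn_curv pull_conn a b u) *v (?E *v Y u))
      + (hess a u *v X u) \<bullet> (?HP *v (hess b u *v Y u))
      - (hess b u *v X u) \<bullet> (?HP *v (hess a u *v Y u))" for a b
    unfolding gauss_equation[OF u] matrix_vector_mult_add_rdistrib matrix_vector_mult_diff_rdistrib
      inner_add_right inner_diff_right
    by (simp only: matrix_mul_assoc[symmetric] inner_transpose_mult)
      (simp add: matrix_vector_mul_assoc matrix_mul_assoc)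
  show ?thesis
    unfolding curvature4_eq_conn_curv[OF open_W u metric_conn_g_differentiable[OF u] assms g_sym[OF u]]
      entry push_eq_frame comp ambient flip
    unfolding ambient_hess_inner
    by (simp add: distrib_left right_diff_distrib sum.distrib sum_subtractf)
qed

text \<open>Contracting the direction index with a pushed vector recovers its coefficients, since
  \<open>coframe\<close> is a left inverse of \<open>frame\<close>; the other contraction brings in
  \<open>M a ** frame u\<close>. The data are abstract to cover both the mixed and the lowered
  projection.\<close>

lemma contract_normal_derivative:
  assumes D: "\<And>l m j. D l m j = (\<Sum>a\<in>UNIV. (coframe u *v axis l 1) $ a *\<^sub>R M a) $ m $ j"
    and M: "\<And>a. M a ** frame u = - (P ** hess a u)"
  shows "(\<chi> m. \<Sum>j\<in>UNIV. \<Sum>l\<in>UNIV. D l m j * push x u \<xi> $ j * push x u \<zeta> $ l)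
    = - (P *v ambient_hess u \<zeta> \<xi>)"
proof -
  have "(\<Sum>j\<in>UNIV. \<Sum>l\<in>UNIV. D l m j * y $ j * z $ l)
      = (\<Sum>a\<in>UNIV. (coframe u *v z) $ a *\<^sub>R (M a *v y)) $ m" for m y z
    by (simp add: D matrix_vector_mult_basis column_def matrix_vector_mult_def[of _ z]
        matrix_vector_mult_def[of _ y] sum_distrib_left sum_distrib_right sum.cartesian_product)
      (rule sum.reindex_bij_witness[where i = "\<lambda>(a,j,l). (j,l,a)" and j = "\<lambda>(j,l,a). (a,j,l)"],
        auto simp: mult_ac)
  then have "(\<chi> m. \<Sum>j\<in>UNIV. \<Sum>l\<in>UNIV. D l m j * push x u \<xi> $ j * push x u \<zeta> $ l)
      = (\<Sum>a\<in>UNIV. \<zeta> $ a *\<^sub>R (M a ** frame u *v \<xi>))"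
    by (simp add: vec_eq_iff push_eq_frame matrix_vector_mul_assoc coframe_frame[OF u])
  also have "\<dots> = - (P *v ambient_hess u \<zeta> \<xi>)"
    by (simp add: M ambient_hess_def bounded_bilinear.sum_right[OF bounded_bilinear_matrix_vector_mult]
        bounded_bilinear.minus_left[OF bounded_bilinear_matrix_vector_mult] matrix_vector_mul_assoc
        matrix_vector_mult_scaleR sum_negf)
  finally show ?thesis .
qed

end

end

theorem proposition3p10:
  fixes U :: "(real^'m::finite) set" and \<eta> :: "real^'m \<Rightarrow> real^'m^'m"
    and W :: "(real^'n::finite) set" and x :: "real^'n \<Rightarrow> real^'m"
    and N :: nat and br :: "(real^'n \<Rightarrow> real) list \<Rightarrow> real^'n \<Rightarrow> real"
    and \<epsilon> :: real and \<gamma> :: "real^'n \<Rightarrow> real"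
    and X Y Z V :: "real^'n \<Rightarrow> real^'n"
  assumes "open U" and "pseudo_metric_on U \<eta>"
    and "open W" and "immersion_on W x" and "x ` W \<subseteq> U"
    and "\<forall>u\<in>W. invertible (induced_metric \<eta> x u)"
    and "leibniz_bracket_on W N br"
    and "\<epsilon> \<in> {-1, 1}"
    and "smooth_on W \<gamma>" and "\<forall>u\<in>W. \<gamma> u > 0"
    and "bracket_compatible_on W br N \<eta> x \<epsilon> \<gamma>"
    and "smooth_field_on W X" and "smooth_field_on W Y"
    and "smooth_field_on W Z" and "smooth_field_on W V"
  shows "\<forall>u\<in>W. curvature4 (induced_metric \<eta> x) X Y Z V u =
    (\<Sum>i\<in>UNIV. \<Sum>j\<in>UNIV. \<Sum>k\<in>UNIV. \<Sum>l\<in>UNIV.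
      (curvature_comp \<eta> i j k l (x u)
       + (\<Sum>m\<in>UNIV. hat_nabla_Pi_low br N \<eta> x \<epsilon> \<gamma> u k m i * hat_nabla_Pi br N \<eta> x \<epsilon> \<gamma> u l m j)
       - (\<Sum>m\<in>UNIV. hat_nabla_Pi_low br N \<eta> x \<epsilon> \<gamma> u k m j * hat_nabla_Pi br N \<eta> x \<epsilon> \<gamma> u l m i))
      * push x u (X u) $ i * push x u (Y u) $ j * push x u (Z u) $ k * push x u (V u) $ l)"
proof
  fix u assume u: "u \<in> W"
  interpret submanifold U \<eta> W x
    using assms by unfold_locales auto
  let ?Pi = "bracket_Pi br N \<eta> x \<epsilon> \<gamma>" and ?Pi_low = "bracket_Pi_low br N \<eta> x \<epsilon> \<gamma>"
  have D: "bracket_D_mixed br N \<eta> x \<epsilon> \<gamma> v = frame v ** coframe v" if "v \<in> W" for v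
    using assms(10) that by (intro bracket_D_mixed_eq assms) auto
  then have Pi: "normal_proj v = ?Pi v" "\<eta> (x v) ** normal_proj v = ?Pi_low v" if "v \<in> W" for v
    using that by (simp_all add: bracket_Pi_low_def bracket_Pi_def normal_proj_def)
  \<comment> \<open>The bracket expressions are identified with the projection on \<open>W\<close>
    only, so differentiability is transferred on this open set.\<close>
  have Pi_diff: "?Pi differentiable at u" "?Pi_low differentiable at u"
    using differentiable_cong[OF assms(3) u Pi(1) normal_proj_differentiable[OF u]]
      differentiable_cong[OF assms(3) u Pi(2)
        differentiable_matrix_mult[OF eta_differentiable[OF u] normal_proj_differentiable[OF u]]]
    by auto
  have Pi_frame: "?Pi v ** frame v = 0" "?Pi_low v ** frame v = 0" if "v \<in> W" for v
    using normal_proj_frame[OF that] Pi[OF that, symmetric] by (simp_all add: matrix_mul_assoc[symmetric])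
  have up: "(\<chi> m. \<Sum>j\<in>UNIV. \<Sum>l\<in>UNIV. hat_nabla_Pi br N \<eta> x \<epsilon> \<gamma> u l m j * push x u \<xi> $ j * push x u \<zeta> $ l)
      = - (normal_proj u *v ambient_hess u \<zeta> \<xi>)" for \<zeta> \<xi>
    unfolding Pi(1)[OF u]
    by (rule contract_normal_derivative[OF u _ pdv_annihilator[OF u Pi_diff(1) Pi_frame(1)]])
      (simp only: hat_nabla_Pi_def D[OF u] matrix_vector_mul_assoc[symmetric]
        covderiv_up_low_frame[OF u Pi_diff(1)])
  \<comment> \<open>The instance of \<open>pdv_annihilator\<close> with left factor minus the
    transposed connection, as two lower indices require.\<close>
  have annihilated: "(pdv a ?Pi_low u - transpose (pull_conn a u) ** ?Pi_low u
      - ?Pi_low u ** pull_conn a u) ** frame u = - (?Pi_low u ** hess a u)" for a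
    using pdv_annihilator[OF u Pi_diff(2) Pi_frame(2), of a "- transpose (pull_conn a u)"]
    by (simp add: bounded_bilinear.minus_left[OF bounded_bilinear_matrix_mult])
  have low: "(\<chi> m. \<Sum>i\<in>UNIV. \<Sum>k\<in>UNIV. hat_nabla_Pi_low br N \<eta> x \<epsilon> \<gamma> u k m i * push x u \<xi> $ i * push x u \<zeta> $ k)
      = - ((\<eta> (x u) ** normal_proj u) *v ambient_hess u \<zeta> \<xi>)" for \<zeta> \<xi>
    unfolding Pi(2)[OF u]
    by (rule contract_normal_derivative[OF u _ annihilated])
      (simp only: hat_nabla_Pi_low_def D[OF u] matrix_vector_mul_assoc[symmetric]
        covderiv_low_low_frame[OF u Pi_diff(2)])
  show "curvature4 g X Y Z V u =
    (\<Sum>i\<in>UNIV. \<Sum>j\<in>UNIV. \<Sum>k\<in>UNIV. \<Sum>l\<in>UNIV.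
      (curvature_comp \<eta> i j k l (x u)
       + (\<Sum>m\<in>UNIV. hat_nabla_Pi_low br N \<eta> x \<epsilon> \<gamma> u k m i * hat_nabla_Pi br N \<eta> x \<epsilon> \<gamma> u l m j)
       - (\<Sum>m\<in>UNIV. hat_nabla_Pi_low br N \<eta> x \<epsilon> \<gamma> u k m j * hat_nabla_Pi br N \<eta> x \<epsilon> \<gamma> u l m i))
      * push x u (X u) $ i * push x u (Y u) $ j * push x u (Z u) $ k * push x u (V u) $ l)"
    \<comment> \<open>The minus signs of \<open>up\<close> and \<open>low\<close> cancel in each
      product, and \<open>normal_proj_inner\<close> merges the two projections into one.\<close>
    unfolding contract_quadratic up low curvature4_gauss[OF u assms(13-15)]
    by (simp add: normal_proj_inner[OF u])
qed

end
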